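(* If $f$ is a maximal null coloring of a finite graph $G$, then the quotient graph $G/f$ is a forest.
   Context: A $k$-coloring of a graph $G$ is a surjective map $f:V(G)\to\{1,\dots,k\}$ (not necessarily proper). Regarding graphs as topological spaces (1-dimensional cell complexes), a $k$-coloring is viewed as a continuous map $f:G\to K_k$ (complete graph on vertex set $\{1,\dots,k\}$) sending each vertex to its color and each edge linearly onto the edge between the colors of its endpoints, or constantly to a vertex if both endpoints have the same color. The coloring $f$ is a null coloring if the induced map $f_*:H_1(G)\to H_1(K_k)$ on first integral homology is zero. A null coloring is maximal if no null coloring of $G$ uses more colors. The quotient graph $G/f$ is the simple graph whose vertices are the color classes of $f$, two distinct classes being adjacent if some edge of $G$ joins a vertex of one to a vertex of the other. *)

theory Defs
  imports "HOL-Homology.Homology"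
begin

text \<open>
  Undirected multigraphs; loops and parallel edges are allowed. The names \<open>end0\<close>, \<open>end1\<close> for the
  two endpoints of an edge fix a parametrisation of the corresponding 1-cell by the unit interval
  and carry no further meaning: the choice is arbitrary for each edge.
\<close>

record ('v, 'e) multigraph =
  verts :: "'v set"
  edges :: "'e set"
  end0 :: "'e \<Rightarrow> 'v"
  end1 :: "'e \<Rightarrow> 'v"

definition finite_graph :: "('v, 'e) multigraph \<Rightarrow> bool" where
  "finite_graph G \<longleftrightarrow> finite (verts G) \<and> finite (edges G) \<and>
     (\<forall>e\<in>edges G. end0 G e \<in> verts G \<and> end1 G e \<in> verts G)"

definition complete_graph :: "nat \<Rightarrow> (nat, nat \<times> nat) multigraph" where
  "complete_graph k =
     \<lparr>verts = {1..k}, edges = {(i, j). i \<in> {1..k} \<and> j \<in> {1..k} \<and> i < j}, end0 = fst, end1 = snd\<rparr>"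

text \<open>
  The 1-dimensional cell complex of a graph. A point is either a vertex \<open>Inl v\<close> or a point
  \<open>Inr (e, t)\<close> with \<open>0 < t < 1\<close> of the open 1-cell of \<open>e\<close>.
\<close>

type_synonym ('v, 'e) point = "'v + 'e \<times> real"

definition points :: "('v, 'e) multigraph \<Rightarrow> ('v, 'e) point set" where
  "points G = Inl ` verts G \<union> Inr ` (edges G \<times> {0<..<1})"

definition cell_map :: "('v, 'e) multigraph \<Rightarrow> 'e \<Rightarrow> real \<Rightarrow> ('v, 'e) point" where
  "cell_map G e t = (if t = 0 then Inl (end0 G e) else if t = 1 then Inl (end1 G e) else Inr (e, t))"

text \<open>The weak topology with respect to the characteristic maps of the 1-cells.\<close>

definition graph_topology :: "('v, 'e) multigraph \<Rightarrow> ('v, 'e) point topology" where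
  "graph_topology G = topology (\<lambda>U. U \<subseteq> points G \<and>
     (\<forall>e\<in>edges G. openin (top_of_set {0..1}) {t \<in> {0..1}. cell_map G e t \<in> U}))"

lemma openin_graph_topology:
  "openin (graph_topology G) U \<longleftrightarrow> U \<subseteq> points G \<and>
     (\<forall>e\<in>edges G. openin (top_of_set {0..1}) {t \<in> {0..1}. cell_map G e t \<in> U})"
proof -
  let ?P = "\<lambda>U. U \<subseteq> points G \<and>
     (\<forall>e\<in>edges G. openin (top_of_set {0..1}) {t \<in> {0..1}. cell_map G e t \<in> U})"
  have "istopology ?P"
    unfolding istopology_def
  proof (intro conjI allI impI)
    fix S T assume ST: "?P S" "?P T"
    then show "S \<inter> T \<subseteq> points G" by blast
    show "\<forall>e\<in>edges G. openin (top_of_set {0..1}) {t \<in> {0..1}. cell_map G e t \<in> S \<inter> T}"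
    proof
      fix e assume "e \<in> edges G"
      moreover have "{t \<in> {0..1}. cell_map G e t \<in> S \<inter> T} =
          {t \<in> {0..1}. cell_map G e t \<in> S} \<inter> {t \<in> {0..1}. cell_map G e t \<in> T}"
        by blast
      ultimately show "openin (top_of_set {0..1}) {t \<in> {0..1}. cell_map G e t \<in> S \<inter> T}"
        using ST by (simp add: openin_Int)
    qed
  next
    fix \<K> assume K: "\<forall>K\<in>\<K>. ?P K"
    then show "\<Union>\<K> \<subseteq> points G" by blast
    show "\<forall>e\<in>edges G. openin (top_of_set {0..1}) {t \<in> {0..1}. cell_map G e t \<in> \<Union>\<K>}"
    proof
      fix e assume "e \<in> edges G"
      moreover have "{t \<in> {0..1}. cell_map G e t \<in> \<Union>\<K>} =
          \<Union>((\<lambda>K. {t \<in> {0..1}. cell_map G e t \<in> K}) ` \<K>)"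
        by blast
      ultimately show "openin (top_of_set {0..1}) {t \<in> {0..1}. cell_map G e t \<in> \<Union>\<K>}"
        using K by (auto intro: openin_Union)
    qed
  qed
  then show ?thesis
    by (simp add: graph_topology_def topology_inverse')
qed

lemma cell_map_in_points:
  assumes "finite_graph G" "e \<in> edges G" "t \<in> {0..1}"
  shows "cell_map G e t \<in> points G"
  using assms by (auto simp: cell_map_def points_def finite_graph_def)

lemma topspace_graph_topology:
  assumes "finite_graph G"
  shows "topspace (graph_topology G) = points G"
proof -
  have "{t \<in> {0..1}. cell_map G e t \<in> points G} = {0..1}" if "e \<in> edges G" for e
    using cell_map_in_points[OF assms that] by blast
  then have "openin (graph_topology G) (points G)"
    by (simp add: openin_graph_topology)
  then show ?thesis
    by (metis openin_graph_topology openin_subset openin_topspace subset_antisym)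
qed

lemma continuous_cell_map:
  assumes "finite_graph G" "e \<in> edges G"
  shows "continuous_map (top_of_set {0..1}) (graph_topology G) (cell_map G e)"
  using assms
  by (auto simp: continuous_map_def topspace_graph_topology openin_graph_topology cell_map_in_points)

lemma continuous_map_graph_topology:
  assumes "finite_graph G" "\<And>v. v \<in> verts G \<Longrightarrow> h (Inl v) \<in> topspace Y"
    and "\<And>e. e \<in> edges G \<Longrightarrow> continuous_map (top_of_set {0..1}) Y (h \<circ> cell_map G e)"
  shows "continuous_map (graph_topology G) Y h"
  unfolding continuous_map_def
proof (intro conjI allI impI)
  have "h (Inr (e, t)) \<in> topspace Y" if "e \<in> edges G" "0 < t" "t < 1" for e t
  proof -
    have "(h \<circ> cell_map G e) t \<in> topspace Y"
      using assms(3)[OF that(1)] that by (auto simp: continuous_map_def)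
    then show ?thesis using that by (simp add: cell_map_def)
  qed
  then show "h \<in> topspace (graph_topology G) \<rightarrow> topspace Y"
    using assms(1,2) by (auto simp: topspace_graph_topology points_def)
  fix U assume U: "openin Y U"
  have "{t \<in> {0..1}. cell_map G e t \<in> {x \<in> points G. h x \<in> U}} =
      {t \<in> topspace (top_of_set {0..1}). (h \<circ> cell_map G e) t \<in> U}" if "e \<in> edges G" for e
    using cell_map_in_points[OF assms(1) that] by auto
  then show "openin (graph_topology G) {x \<in> topspace (graph_topology G). h x \<in> U}"
    using assms(1,3) U
    by (simp add: topspace_graph_topology openin_graph_topology continuous_map_def)
qed

definition coloring :: "('v, 'e) multigraph \<Rightarrow> nat \<Rightarrow> ('v \<Rightarrow> nat) \<Rightarrow> bool" where
  "coloring G k f \<longleftrightarrow> f ` verts G = {1..k}"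

text \<open>
  The linear path from vertex \<open>i\<close> to vertex \<open>j\<close> along the edge of the complete graph joining them
  (constant if \<open>i = j\<close>).
\<close>

definition linear_path :: "nat \<Rightarrow> nat \<Rightarrow> nat \<Rightarrow> real \<Rightarrow> (nat, nat \<times> nat) point" where
  "linear_path k i j t =
     (if i = j then Inl i
      else if i < j then cell_map (complete_graph k) (i, j) t
      else cell_map (complete_graph k) (j, i) (1 - t))"

fun coloring_map :: "('v, 'e) multigraph \<Rightarrow> nat \<Rightarrow> ('v \<Rightarrow> nat) \<Rightarrow>
    ('v, 'e) point \<Rightarrow> (nat, nat \<times> nat) point" where
  "coloring_map G k f (Inl v) = Inl (f v)"
| "coloring_map G k f (Inr (e, t)) = linear_path k (f (end0 G e)) (f (end1 G e)) t"

lemma finite_complete_graph: "finite_graph (complete_graph k)"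
proof -
  have "{(i, j). i \<in> {1..k} \<and> j \<in> {1..k} \<and> i < j} \<subseteq> {1..k} \<times> {1..k}" by auto
  then have "finite {(i, j). i \<in> {1..k} \<and> j \<in> {1..k} \<and> i < j}"
    by (rule finite_subset) simp
  then show ?thesis by (auto simp: finite_graph_def complete_graph_def)
qed

lemma vertex_in_complete_graph:
  "Inl i \<in> topspace (graph_topology (complete_graph k)) \<longleftrightarrow> i \<in> {1..k}"
  unfolding topspace_graph_topology[OF finite_complete_graph]
  by (auto simp: points_def complete_graph_def)

lemma continuous_linear_path:
  assumes "i \<in> {1..k}" "j \<in> {1..k}"
  shows "continuous_map (top_of_set {0..1}) (graph_topology (complete_graph k)) (linear_path k i j)"
proof -
  consider "i = j" | "i < j" | "j < i" by linarith
  then show ?thesis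
  proof cases
    case 1
    then have "linear_path k i j = (\<lambda>t. Inl i)" by (auto simp: linear_path_def)
    moreover have "Inl i \<in> topspace (graph_topology (complete_graph k))"
      using assms by (simp add: vertex_in_complete_graph)
    ultimately show ?thesis by simp
  next
    case 2
    then have "linear_path k i j = cell_map (complete_graph k) (i, j)"
      by (auto simp: linear_path_def)
    moreover have "(i, j) \<in> edges (complete_graph k)"
      using 2 assms by (simp add: complete_graph_def)
    ultimately show ?thesis
      by (simp add: continuous_cell_map[OF finite_complete_graph])
  next
    case 3
    then have *: "linear_path k i j = cell_map (complete_graph k) (j, i) \<circ> (\<lambda>t. 1 - t)"
      by (auto simp: linear_path_def)
    have "(j, i) \<in> edges (complete_graph k)"
      using 3 assms by (simp add: complete_graph_def)
    moreover have "continuous_map (top_of_set {0..1}) (top_of_set {0..1}) (\<lambda>t::real. 1 - t)"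
      by (auto intro: continuous_intros)
    ultimately show ?thesis
      unfolding * by (blast intro: continuous_map_compose continuous_cell_map[OF finite_complete_graph])
  qed
qed

lemma continuous_coloring_map:
  assumes "finite_graph G" "coloring G k f"
  shows "continuous_map (graph_topology G) (graph_topology (complete_graph k)) (coloring_map G k f)"
proof (rule continuous_map_graph_topology[OF assms(1)])
  fix v assume "v \<in> verts G"
  then show "coloring_map G k f (Inl v) \<in> topspace (graph_topology (complete_graph k))"
    using assms(2) unfolding coloring_def coloring_map.simps vertex_in_complete_graph by blast
next
  fix e assume "e \<in> edges G"
  then have "f (end0 G e) \<in> {1..k}" "f (end1 G e) \<in> {1..k}"
    using assms by (auto simp: finite_graph_def coloring_def)
  moreover have "coloring_map G k f \<circ> cell_map G e = linear_path k (f (end0 G e)) (f (end1 G e))"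
    by (auto simp: cell_map_def linear_path_def complete_graph_def)
  ultimately show "continuous_map (top_of_set {0..1}) (graph_topology (complete_graph k))
      (coloring_map G k f \<circ> cell_map G e)"
    by (simp add: continuous_linear_path)
qed

text \<open>
  The library's \<open>hom_induced\<close> is trivial for discontinuous maps; \<open>continuous_coloring_map\<close> shows
  that this default never applies below.
\<close>

definition null_coloring :: "('v, 'e) multigraph \<Rightarrow> nat \<Rightarrow> ('v \<Rightarrow> nat) \<Rightarrow> bool" where
  "null_coloring G k f \<longleftrightarrow> coloring G k f \<and>
     (\<forall>c \<in> carrier (homology_group 1 (graph_topology G)).
        hom_induced 1 (graph_topology G) {} (graph_topology (complete_graph k)) {} (coloring_map G k f) c
        = \<one>\<^bsub>homology_group 1 (graph_topology (complete_graph k))\<^esub>)"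

definition maximal_null_coloring :: "('v, 'e) multigraph \<Rightarrow> nat \<Rightarrow> ('v \<Rightarrow> nat) \<Rightarrow> bool" where
  "maximal_null_coloring G k f \<longleftrightarrow> null_coloring G k f \<and>
     (\<forall>k' f'. null_coloring G k' f' \<longrightarrow> k' \<le> k)"

text \<open>Simple graphs, with edges given as two-element sets of vertices.\<close>

record 'a simple_graph =
  sverts :: "'a set"
  sedges :: "'a set set"

definition color_class :: "('v, 'e) multigraph \<Rightarrow> ('v \<Rightarrow> nat) \<Rightarrow> nat \<Rightarrow> 'v set" where
  "color_class G f c = {v \<in> verts G. f v = c}"

definition quotient_graph :: "('v, 'e) multigraph \<Rightarrow> ('v \<Rightarrow> nat) \<Rightarrow> 'v set simple_graph" where
  "quotient_graph G f =
     \<lparr>sverts = color_class G f ` (f ` verts G),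
      sedges = {{A, B} | A B. A \<in> color_class G f ` (f ` verts G) \<and> B \<in> color_class G f ` (f ` verts G) \<and>
        A \<noteq> B \<and> (\<exists>e\<in>edges G. end0 G e \<in> A \<and> end1 G e \<in> B)}\<rparr>"

definition cycle :: "'a simple_graph \<Rightarrow> 'a list \<Rightarrow> bool" where
  "cycle H xs \<longleftrightarrow> 3 \<le> length xs \<and> distinct xs \<and> set xs \<subseteq> sverts H \<and>
     (\<forall>i < length xs. {xs ! i, xs ! (Suc i mod length xs)} \<in> sedges H)"

definition forest :: "'a simple_graph \<Rightarrow> bool" where
  "forest H \<longleftrightarrow> (\<nexists>xs. cycle H xs)"

end

theory Submission
  imports Defs "HOL-Analysis.Further_Topology" "HOL-Analysis.Abstract_Topological_Spaces"
begin

text \<open>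
  Let \<open>f\<close> be null and let \<open>A\<close>, \<open>B\<close> be adjacent color classes. The winding number of the image of a
  cycle of \<open>G\<close> around the edge of \<open>K\<^sub>k\<close> joining the two colors vanishes, so there is a potential on
  the vertices of \<open>G\<close> that changes exactly along the edges between \<open>A\<close> and \<open>B\<close>. Normalised to vanish
  at a chosen root of each component, its support is a cut of \<open>G\<close> avoiding the roots and crossed by
  edges between \<open>A\<close> and \<open>B\<close> only. Hence \<open>G\<close> has as many pairwise edge-disjoint cuts avoiding the
  roots as \<open>G/f\<close> has edges.

  Such a family can be uncrossed into a laminar one of the same size. Coloring each vertex by the
  innermost member containing it, or by its root if there is none, uses one color for each cut and
  each root. This coloring is null: deleting an inclusion-minimal member moves colors along single
  edges of the complete graph only, hence does not change the homotopy class, and the coloring for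
  the empty family is constant on components. If \<open>G/f\<close> contained a cycle, then its number of vertices
  would be smaller than its number of edges plus the number of roots, contradicting maximality.
\<close>

subsection \<open>Edge-disjoint cuts\<close>

text \<open>The edges selected here form the cut of \<open>A\<close>; a loop is never among them,
  and \<open>A\<close> and its complement have the same cut.\<close>

definition separates :: "('v, 'e) multigraph \<Rightarrow> 'v set \<Rightarrow> 'e \<Rightarrow> bool" where
  "separates G A e \<longleftrightarrow> (end0 G e \<in> A) \<noteq> (end1 G e \<in> A)"

definition edge_disjoint_cuts :: "('v, 'e) multigraph \<Rightarrow> 'v set set \<Rightarrow> bool" where
  "edge_disjoint_cuts G F \<longleftrightarrow>
     (\<forall>A\<in>F. \<forall>B\<in>F. A \<noteq> B \<longrightarrow> (\<forall>e\<in>edges G. \<not> (separates G A e \<and> separates G B e)))"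

definition laminar :: "'a set set \<Rightarrow> bool" where
  "laminar F \<longleftrightarrow> (\<forall>A\<in>F. \<forall>B\<in>F. A \<inter> B = {} \<or> A \<subseteq> B \<or> B \<subseteq> A)"

section \<open>Roots of connected components\<close>

text \<open>The last clause says that \<open>v\<close> and \<open>r v\<close> are joined by a walk.\<close>

definition component_rep :: "('v, 'e) multigraph \<Rightarrow> ('v \<Rightarrow> 'v) \<Rightarrow> bool" where
  "component_rep G r \<longleftrightarrow> (\<forall>v\<in>verts G. r v \<in> verts G) \<and> (\<forall>v. r (r v) = r v) \<and>
     (\<forall>e\<in>edges G. r (end0 G e) = r (end1 G e)) \<and>
     (\<forall>P v. P (r v) \<longrightarrow> (\<forall>e\<in>edges G. P (end0 G e) \<longleftrightarrow> P (end1 G e)) \<longrightarrow> P v)"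

lemma component_rep_verts: "\<lbrakk>component_rep G r; v \<in> verts G\<rbrakk> \<Longrightarrow> r v \<in> verts G"
  and component_rep_idem: "component_rep G r \<Longrightarrow> r (r v) = r v"
  and component_rep_edge: "\<lbrakk>component_rep G r; e \<in> edges G\<rbrakk> \<Longrightarrow> r (end0 G e) = r (end1 G e)"
  by (simp_all add: component_rep_def)

text \<open>Connectedness enters later arguments through this principle: a property that does not
  change across edges spreads from a root over its component.\<close>

lemma component_rep_induct:
  assumes "component_rep G r" "P (r v)" "\<And>e. e \<in> edges G \<Longrightarrow> P (end0 G e) \<longleftrightarrow> P (end1 G e)"
  shows "P v"
  using assms unfolding component_rep_def by blast

lemma component_rep_exists:
  fixes G :: "('v, 'e) multigraph"
  assumes "finite_graph G"
  obtains r where "component_rep G r"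
proof -
  define S where "S = {(end0 G e, end1 G e) | e. e \<in> edges G} \<union> {(end1 G e, end0 G e) | e. e \<in> edges G}"
  \<comment> \<open>The choice depends only on the set of vertices reachable from \<open>v\<close>,
    which is the same throughout a component.\<close>
  define r where "r v = (SOME u. (v, u) \<in> S\<^sup>*)" for v
  have symS: "sym (S\<^sup>*)"
    by (rule sym_rtrancl) (auto simp: S_def sym_def)
  have r: "(v, r v) \<in> S\<^sup>*" for v
    unfolding r_def by (rule someI) (rule rtrancl_refl)
  have r_eq: "r u = r v" if "(u, v) \<in> S\<^sup>*" for u v
  proof -
    have "(u, w) \<in> S\<^sup>* \<longleftrightarrow> (v, w) \<in> S\<^sup>*" for w
      using that symS by (meson rtrancl_trans symD)
    then show ?thesis by (simp add: r_def)
  qed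
  have "component_rep G r"
    unfolding component_rep_def
  proof (intro conjI ballI allI impI)
    fix v assume "v \<in> verts G"
    from r[of v] this show "r v \<in> verts G"
      using assms by (induction rule: rtrancl_induct) (auto simp: S_def finite_graph_def)
  next
    show "r (r v) = r v" for v using r_eq[OF r] by simp
  next
    fix e assume "e \<in> edges G"
    then have "(end0 G e, end1 G e) \<in> S" by (auto simp: S_def)
    then show "r (end0 G e) = r (end1 G e)" by (blast intro: r_eq)
  next
    fix P v assume P: "P (r v)" "\<forall>e\<in>edges G. P (end0 G e) \<longleftrightarrow> P (end1 G e)"
    have "(r v, v) \<in> S\<^sup>*" using r symS by (meson symD)
    then show "P v"
      by (induction rule: rtrancl_induct) (use P in \<open>auto simp: S_def\<close>)
  qed
  then show thesis by (rule that)
qed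

section \<open>Uncrossing edge-disjoint cuts\<close>

text \<open>Among all edge-disjoint families of the given size, one maximising the sum of the squared
  cardinalities is laminar: replacing crossing members \<open>A\<close>, \<open>B\<close> by \<open>A \<inter> B\<close>, \<open>A \<union> B\<close> increases the sum.\<close>

lemma exists_laminar_cuts:
  fixes G :: "('v, 'e) multigraph"
  assumes "finite U" and FU: "F \<subseteq> Pow U - {{}}" and F: "edge_disjoint_cuts G F"
    and sep: "\<And>A. \<lbrakk>A \<subseteq> U; A \<noteq> {}\<rbrakk> \<Longrightarrow> \<exists>e\<in>edges G. separates G A e"
  obtains F' where "F' \<subseteq> Pow U - {{}}" "edge_disjoint_cuts G F'" "laminar F'" "card F' = card F"
proof -
  define \<C> where "\<C> = {F'. F' \<subseteq> Pow U - {{}} \<and> edge_disjoint_cuts G F' \<and> card F' = card F}"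
  define w where "w F' = (\<Sum>A\<in>F'. (card A)\<^sup>2)" for F' :: "'v set set"
  have finU: "finite (Pow U - {{}})" using \<open>finite U\<close> by simp
  have "\<C> \<subseteq> Pow (Pow U - {{}})" by (auto simp: \<C>_def)
  then have fin: "finite \<C>" using finU by (meson finite_Pow_iff finite_subset)
  have "F \<in> \<C>" using FU F by (simp add: \<C>_def)
  then have "Max (w ` \<C>) \<in> w ` \<C>" using fin by (intro Max_in) auto
  then obtain M where M: "M \<in> \<C>" "w M = Max (w ` \<C>)" by auto
  then have Mmax: "w F' \<le> w M" if "F' \<in> \<C>" for F' using that fin by simp
  have MU: "M \<subseteq> Pow U - {{}}" and Mdis: "edge_disjoint_cuts G M" and Mcard: "card M = card F"
    using M by (auto simp: \<C>_def)
  have finM: "finite M" using MU finU finite_subset by blast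
  have "laminar M"
    unfolding laminar_def
  proof (intro ballI, rule ccontr)
    fix A B assume AB: "A \<in> M" "B \<in> M" and "\<not> (A \<inter> B = {} \<or> A \<subseteq> B \<or> B \<subseteq> A)"
    then have ne: "A \<inter> B \<noteq> {}" "\<not> A \<subseteq> B" "\<not> B \<subseteq> A" by auto
    define N where "N = (M - {A, B}) \<union> {A \<inter> B, A \<union> B}"
    have U: "A \<subseteq> U" "B \<subseteq> U" using AB MU by auto
    have fins: "finite A" "finite B" using U \<open>finite U\<close> finite_subset by auto
    have disj: "\<not> (separates G C e \<and> separates G D e)" if "C \<in> M" "D \<in> M" "C \<noteq> D" "e \<in> edges G" for C D e
      using Mdis that unfolding edge_disjoint_cuts_def by blast
    have sepsub: "separates G A e \<or> separates G B e"
      if "separates G (A \<inter> B) e \<or> separates G (A \<union> B) e" for e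
      using that by (auto simp: separates_def)
    \<comment> \<open>Such an edge would run from \<open>A \<inter> B\<close> to the complement of
      \<open>A \<union> B\<close>, hence be cut by both \<open>A\<close> and
      \<open>B\<close>.\<close>
    have notboth: "\<not> (separates G (A \<inter> B) e \<and> separates G (A \<union> B) e)" if "e \<in> edges G" for e
    proof -
      have "A \<noteq> B" using ne by auto
      then have "\<not> (separates G A e \<and> separates G B e)" using disj AB that by blast
      then show ?thesis by (auto simp: separates_def)
    qed
    \<comment> \<open>A new set that was already a member would share one of its cut edges with
      \<open>A\<close> or \<open>B\<close>. So the replacement preserves the cardinality of the
      family.\<close>
    have new: "C \<notin> M - {A, B}" if C: "C = A \<inter> B \<or> C = A \<union> B" for C
    proof
      assume CM: "C \<in> M - {A, B}"
      have "C \<subseteq> U" "C \<noteq> {}" using C U ne by auto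
      then obtain e where e: "e \<in> edges G" "separates G C e" using sep by blast
      then have "separates G A e \<or> separates G B e" using sepsub C by blast
      then show False using disj[of C A e] disj[of C B e] e CM AB by blast
    qed
    have neq: "A \<inter> B \<noteq> A \<union> B" using ne by blast
    have "A \<noteq> B" using ne by auto
    then have "card M = card (M - {A, B}) + 2"
      using AB finM card_Diff_subset[of "{A, B}" M] card_mono[of M "{A, B}"] by simp
    moreover have "card N = card (M - {A, B}) + 2"
      unfolding N_def using new neq finM by (subst card_Un_disjoint) auto
    ultimately have "card N = card F" using Mcard by simp
    moreover have "N \<subseteq> Pow U - {{}}" using MU U ne by (auto simp: N_def)
    moreover have "edge_disjoint_cuts G N"
    proof -
      have newold: "\<not> (separates G C e \<and> separates G D e)"
        if "C = A \<inter> B \<or> C = A \<union> B" "D \<in> M - {A, B}" "e \<in> edges G" for C D e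
      proof
        assume s: "separates G C e \<and> separates G D e"
        then have "separates G A e \<or> separates G B e" using sepsub that(1) by metis
        then show False using disj[of D A e] disj[of D B e] s that(2,3) AB by simp
      qed
      show ?thesis
        unfolding edge_disjoint_cuts_def
      proof (intro ballI impI)
        fix C D e assume CD: "C \<in> N" "D \<in> N" "C \<noteq> D" and e: "e \<in> edges G"
        have C: "C \<in> M - {A, B} \<or> C = A \<inter> B \<or> C = A \<union> B"
          and D: "D \<in> M - {A, B} \<or> D = A \<inter> B \<or> D = A \<union> B"
          using CD unfolding N_def by (simp_all, metis+)
        show "\<not> (separates G C e \<and> separates G D e)"
          using C
        proof (elim disjE)
          assume CM: "C \<in> M - {A, B}"
          show ?thesis using D
          proof
            assume "D \<in> M - {A, B}"
            then show ?thesis using CM disj[of C D e] CD(3) e by simp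
          next
            assume "D = A \<inter> B \<or> D = A \<union> B"
            then show ?thesis using newold[of D C e] CM e by blast
          qed
        next
          assume CI: "C = A \<inter> B"
          then show ?thesis using D newold[of C D e] notboth[OF e] CD(3) e by metis
        next
          assume CU: "C = A \<union> B"
          then show ?thesis using D newold[of C D e] notboth[OF e] CD(3) e by metis
        qed
      qed
    qed
    ultimately have "N \<in> \<C>" by (simp add: \<C>_def)
    then have "w N \<le> w M" by (rule Mmax)
    moreover have "w M = w (M - {A, B}) + ((card A)\<^sup>2 + (card B)\<^sup>2)"
    proof -
      have "w M = w (M - {A, B}) + w {A, B}"
        unfolding w_def using AB finM by (intro sum.subset_diff) auto
      then show ?thesis using \<open>A \<noteq> B\<close> by (simp add: w_def)
    qed
    moreover have "w N = w (M - {A, B}) + ((card (A \<inter> B))\<^sup>2 + (card (A \<union> B))\<^sup>2)"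
    proof -
      have "w N = w (M - {A, B}) + w {A \<inter> B, A \<union> B}"
        unfolding w_def N_def using new finM by (intro sum.union_disjoint) auto
      then show ?thesis using neq by (simp add: w_def)
    qed
    moreover have "(card A)\<^sup>2 + (card B)\<^sup>2 < (card (A \<inter> B))\<^sup>2 + (card (A \<union> B))\<^sup>2"
    proof -
      \<comment> \<open>The right-hand side exceeds the left by
        \<open>2 * card (A - B) * card (B - A)\<close>.\<close>
      have "card (A - B) > 0" "card (B - A) > 0" using ne fins by (auto simp: card_gt_0_iff)
      moreover have "card A = card (A \<inter> B) + card (A - B)"
        using fins by (metis card_Int_Diff)
      moreover have "card B = card (A \<inter> B) + card (B - A)"
        using fins by (metis card_Int_Diff inf_commute)
      moreover have "card (A \<union> B) = card (A \<inter> B) + card (A - B) + card (B - A)"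
        using fins card_Un_Int[of A B] calculation by linarith
      ultimately show ?thesis by (simp add: power2_eq_square algebra_simps)
    qed
    ultimately show False by linarith
  qed
  then show thesis using MU Mdis Mcard that by blast
qed

text \<open>Members containing \<open>v\<close> meet pairwise, so laminarity makes them a finite
  chain, and the intersection is its least element.\<close>

lemma Inter_laminar_mem:
  assumes "finite F" "laminar F" "{A \<in> F. v \<in> A} \<noteq> {}"
  shows "\<Inter> {A \<in> F. v \<in> A} \<in> {A \<in> F. v \<in> A}"
proof -
  let ?S = "{A \<in> F. v \<in> A}"
  have "finite ?S" using assms by simp
  from finite_has_minimal[OF this assms(3)]
  obtain A where A: "A \<in> ?S" "\<forall>B\<in>?S. B \<subseteq> A \<longrightarrow> A = B" ..
  have "A \<subseteq> B" if "B \<in> ?S" for B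
  proof -
    have "A \<inter> B = {} \<or> A \<subseteq> B \<or> B \<subseteq> A" using A(1) that assms(2) by (simp add: laminar_def)
    then show ?thesis using A that by auto
  qed
  then have "\<Inter> ?S = A" using A(1) by blast
  then show ?thesis using A(1) by simp
qed

text \<open>An edge leaving a maximal proper submember leaves neither a second submember nor the member
  itself, so the submembers do not exhaust the member.\<close>

lemma exists_innermost_vertex:
  assumes fin: "finite F" and F: "edge_disjoint_cuts G F" "laminar F" "A \<in> F" "A \<noteq> {}"
    and sep: "\<And>B. B \<in> F \<Longrightarrow> \<exists>e\<in>edges G. separates G B e"
  obtains v where "v \<in> A" "\<Inter> {B \<in> F. v \<in> B} = A"
proof (rule ccontr)
  assume "\<not> thesis"
  then have no: "\<And>v. v \<in> A \<Longrightarrow> \<Inter> {B \<in> F. v \<in> B} \<noteq> A" using that by metis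
  define \<S> where "\<S> = {B \<in> F. B \<subset> A}"
  have cover: "\<exists>B\<in>\<S>. v \<in> B" if "v \<in> A" for v
  proof -
    have "{B \<in> F. v \<in> B} \<noteq> {}" using F(3) that by blast
    from Inter_laminar_mem[OF fin F(2) this] no[OF that] that F(3)
    show ?thesis by (intro bexI[of _ "\<Inter> {B \<in> F. v \<in> B}"]) (auto simp: \<S>_def)
  qed
  have "finite \<S>" using fin by (simp add: \<S>_def)
  moreover have "\<S> \<noteq> {}" using cover F(4) by blast
  ultimately obtain B where B: "B \<in> \<S>" "\<And>C. \<lbrakk>C \<in> \<S>; B \<subseteq> C\<rbrakk> \<Longrightarrow> C = B"
    using finite_has_maximal by metis
  then have BF: "B \<in> F" "B \<subset> A" by (auto simp: \<S>_def)
  obtain e where e: "e \<in> edges G" "separates G B e" using sep BF by blast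
  have "\<not> separates G A e" using F(1,3) BF e unfolding edge_disjoint_cuts_def by blast
  \<comment> \<open>Since \<open>B \<subset> A\<close> and \<open>e\<close> does not leave
    \<open>A\<close>, both ends lie in \<open>A\<close>; \<open>y\<close> is the one outside
    \<open>B\<close>.\<close>
  then obtain x y where xy: "{x, y} = {end0 G e, end1 G e}" "x \<in> B" "y \<notin> B" "y \<in> A"
    using e BF unfolding separates_def by blast
  obtain C where C: "C \<in> \<S>" "y \<in> C" using cover xy by blast
  then have "C \<in> F" "C \<noteq> B" using xy by (auto simp: \<S>_def)
  \<comment> \<open>As \<open>e\<close> is already cut by \<open>B\<close>, it is not cut by
    \<open>C\<close>. So \<open>C\<close> also contains \<open>x\<close>, hence meets
    \<open>B\<close> without lying inside it, and laminarity puts \<open>B\<close> inside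
    \<open>C\<close>.\<close>
  then have "\<not> separates G C e" using F(1) BF e unfolding edge_disjoint_cuts_def by blast
  then have "x \<in> C" using xy(1) C unfolding separates_def by (metis doubleton_eq_iff)
  then have "B \<subseteq> C" using F(2) BF \<open>C \<in> F\<close> C xy unfolding laminar_def by blast
  then show False using B(2) C \<open>C \<noteq> B\<close> by blast
qed

section \<open>Colors from innermost members\<close>

text \<open>For a laminar family the intersection is its innermost member containing the vertex.\<close>

definition cut_color :: "('v set \<Rightarrow> nat) \<Rightarrow> ('v \<Rightarrow> nat) \<Rightarrow> 'v set set \<Rightarrow> 'v \<Rightarrow> nat" where
  "cut_color a b F v = (if {A \<in> F. v \<in> A} = {} then b v else a (\<Inter> {A \<in> F. v \<in> A}))"

lemma cut_color_outside: "{A \<in> F. v \<in> A} = {} \<Longrightarrow> cut_color a b F v = b v"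
  unfolding cut_color_def by (rule if_P)

lemma cut_color_inside: "{A \<in> F. v \<in> A} \<noteq> {} \<Longrightarrow> cut_color a b F v = a (\<Inter> {A \<in> F. v \<in> A})"
  unfolding cut_color_def by (rule if_not_P)

text \<open>Only vertices of \<open>A\<close> change color, and by minimality all of them had color
  \<open>a A\<close>. If an end of \<open>e\<close> lies in \<open>A\<close>, no other member
  separates \<open>e\<close>: by edge-disjointness if \<open>e\<close> leaves \<open>A\<close>,
  otherwise because every other member contains or avoids \<open>A\<close>. Both ends then share one
  color after the removal.\<close>

lemma cut_color_remove_minimal:
  assumes F: "edge_disjoint_cuts G F" "laminar F" "A \<in> F"
    and min: "\<And>B. \<lbrakk>B \<in> F; B \<subseteq> A\<rbrakk> \<Longrightarrow> B = A"
    and e: "e \<in> edges G" and b: "b (end0 G e) = b (end1 G e)"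
  shows "\<exists>i j. {cut_color a b F (end0 G e), cut_color a b F (end1 G e),
      cut_color a b (F - {A}) (end0 G e), cut_color a b (F - {A}) (end1 G e)} \<subseteq> {i, j}"
proof -
  have same: "cut_color a b (F - {A}) x = cut_color a b F x" if "x \<notin> A" for x
  proof -
    have "{B \<in> F - {A}. x \<in> B} = {B \<in> F. x \<in> B}" using that by blast
    then show ?thesis unfolding cut_color_def by (simp only:)
  qed
  have nested: "B \<inter> A = {} \<or> A \<subseteq> B" if "B \<in> F" for B
  proof -
    have "B \<inter> A = {} \<or> B \<subseteq> A \<or> A \<subseteq> B" using F(2,3) that by (simp add: laminar_def)
    then show ?thesis using min[OF that] by auto
  qed
  have inA: "cut_color a b F x = a A" if x: "x \<in> A" for x
  proof -
    have "A \<subseteq> B" if "B \<in> F" "x \<in> B" for B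
      using nested[OF that(1)] that(2) x by auto
    then have "\<Inter> {B \<in> F. x \<in> B} = A" using F(3) x by auto
    moreover have "{B \<in> F. x \<in> B} \<noteq> {}" using F(3) x by auto
    ultimately show ?thesis unfolding cut_color_def by (simp only: if_False)
  qed
  have mem: "cut_color a b (F - {A}) (end0 G e) = cut_color a b (F - {A}) (end1 G e)"
    if "\<And>B. B \<in> F - {A} \<Longrightarrow> \<not> separates G B e"
  proof -
    have "{B \<in> F - {A}. end0 G e \<in> B} = {B \<in> F - {A}. end1 G e \<in> B}"
      using that by (auto simp: separates_def)
    then show ?thesis using b unfolding cut_color_def by (simp only:)
  qed
  show ?thesis
  proof (cases "end0 G e \<notin> A \<and> end1 G e \<notin> A")
    case True
    then show ?thesis
      using same[of "end0 G e"] same[of "end1 G e"]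
      by (intro exI[of _ "cut_color a b F (end0 G e)"] exI[of _ "cut_color a b F (end1 G e)"]) simp
  next
    case False
    have "\<not> separates G B e" if B: "B \<in> F - {A}" for B
    proof (cases "separates G A e")
      case True
      then show ?thesis using F(1,3) B e unfolding edge_disjoint_cuts_def by blast
    next
      case nsep: False
      then have "end0 G e \<in> A" "end1 G e \<in> A" using False by (auto simp: separates_def)
      moreover have "B \<inter> A = {} \<or> A \<subseteq> B" using nested B by simp
      ultimately show ?thesis unfolding separates_def by blast
    qed
    then have eq: "cut_color a b (F - {A}) (end0 G e) = cut_color a b (F - {A}) (end1 G e)" by (rule mem)
    have "cut_color a b F x \<in> {a A, cut_color a b (F - {A}) x}" for x
      using same[of x] inA[of x] by (cases "x \<in> A") simp_all
    from this[of "end0 G e"] this[of "end1 G e"] eq show ?thesis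
      by (intro exI[of _ "a A"] exI[of _ "cut_color a b (F - {A}) (end0 G e)"]) simp
  qed
qed

section \<open>Counting vertices against edges\<close>

text \<open>Each vertex outside \<open>R\<close> is charged to the first edge of a shortest path leading it to \<open>R\<close>.\<close>

lemma card_verts_le_roots_plus_edges:
  fixes E :: "'a set set"
  assumes "finite E" "finite R" "finite V"
    and reach: "\<And>v. v \<in> V \<Longrightarrow> \<exists>x\<in>R. (x, v) \<in> {(x, y). {x, y} \<in> E}\<^sup>*"
  shows "card V \<le> card R + card E"
proof -
  define S where "S = {(x, y). {x, y} \<in> E}"
  define P where "P v n \<longleftrightarrow> (\<exists>x\<in>R. (x, v) \<in> S ^^ n)" for v n
  define d where "d v = (LEAST n. P v n)" for v
  have step: "\<exists>u. {u, v} \<in> E \<and> d u < d v" if v: "v \<in> V - R" for v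
  proof -
    have "\<exists>n. P v n" using reach[of v] v unfolding P_def S_def by (auto simp: rtrancl_power)
    then have Pd: "P v (d v)" unfolding d_def by (rule LeastI_ex)
    then obtain x where x: "x \<in> R" "(x, v) \<in> S ^^ d v" by (auto simp: P_def)
    have "d v \<noteq> 0" using x v by (cases "d v = 0") auto
    then obtain n where n: "d v = Suc n" by (cases "d v") auto
    then obtain u where u: "(x, u) \<in> S ^^ n" "(u, v) \<in> S" using x by auto
    then have "d u \<le> n" unfolding d_def using x by (intro Least_le) (auto simp: P_def)
    then show ?thesis using u n by (intro exI[of _ u]) (auto simp: S_def)
  qed
  then obtain p where p: "\<And>v. v \<in> V - R \<Longrightarrow> {p v, v} \<in> E \<and> d (p v) < d v" by metis
  have "inj_on (\<lambda>v. {p v, v}) (V - R)"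
  proof (rule inj_onI)
    fix v w assume vw: "v \<in> V - R" "w \<in> V - R" "{p v, v} = {p w, w}"
    \<comment> \<open>In the second case \<open>d\<close> would decrease both from \<open>v\<close>
      to \<open>w\<close> and from \<open>w\<close> to \<open>v\<close>.\<close>
    then have "v = w \<or> (p v = w \<and> p w = v)" by (auto simp: doubleton_eq_iff)
    then show "v = w" using p[OF vw(1)] p[OF vw(2)] by auto
  qed
  moreover have "(\<lambda>v. {p v, v}) ` (V - R) \<subseteq> E" using p by auto
  ultimately have "card (V - R) \<le> card E" using assms(1) by (rule card_inj_on_le)
  moreover have "card V \<le> card R + card (V - R)"
    using assms card_Un_le[of R "V - R"] card_mono[of "R \<union> (V - R)" V] by fastforce
  ultimately show ?thesis by simp
qed

text \<open>The remaining edges of the cycle still join the two ends of the deleted one, so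
  reachability survives.\<close>

lemma cycle_edge_removable:
  assumes "cycle H xs"
  obtains D where "D \<in> sedges H"
    and "{(x, y). {x, y} \<in> sedges H}\<^sup>* \<subseteq> {(x, y). {x, y} \<in> sedges H - {D}}\<^sup>*"
proof -
  define n where "n = length xs"
  have n: "3 \<le> n" and dist: "distinct xs"
    and ed: "\<And>i. i < n \<Longrightarrow> {xs ! i, xs ! (Suc i mod n)} \<in> sedges H"
    using assms by (auto simp: cycle_def n_def)
  define D where "D = {xs ! 0, xs ! 1}"
  define S where "S = {(x, y). {x, y} \<in> sedges H - {D}}"
  have nth: "xs ! i = xs ! j \<longleftrightarrow> i = j" if "i < n" "j < n" for i j
    using that dist by (simp add: n_def nth_eq_iff_index_eq)
  have path: "i < n \<Longrightarrow> 1 \<le> i \<Longrightarrow> (xs ! 1, xs ! i) \<in> S\<^sup>*" for i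
  proof (induction i)
    case (Suc i)
    show ?case
    proof (cases "i = 0")
      case False
      have "{xs ! i, xs ! Suc i} \<in> sedges H" using ed[of i] Suc.prems by simp
      moreover have "{xs ! i, xs ! Suc i} \<noteq> D"
        using Suc.prems False n nth[of i 0] nth[of "Suc i" 0] nth[of i 1] nth[of "Suc i" 1]
        by (auto simp: D_def doubleton_eq_iff)
      ultimately have "(xs ! i, xs ! Suc i) \<in> S" by (simp add: S_def)
      then show ?thesis using Suc False by (auto intro: rtrancl_into_rtrancl)
    qed simp
  qed simp
  have "Suc (n - 1) mod n = 0" using n by simp
  then have "{xs ! (n - 1), xs ! 0} \<in> sedges H" using ed[of "n - 1"] n by simp
  \<comment> \<open>This uses \<open>3 \<le> n\<close>: with two vertices the closing edge would be
    \<open>D\<close> itself.\<close>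
  moreover have "{xs ! (n - 1), xs ! 0} \<noteq> D"
    using n nth[of "n - 1" 0] nth[of "n - 1" 1] by (auto simp: D_def doubleton_eq_iff)
  ultimately have "(xs ! (n - 1), xs ! 0) \<in> S" by (simp add: S_def)
  then have bwd: "(xs ! 1, xs ! 0) \<in> S\<^sup>*"
    using path[of "n - 1"] n rtrancl_into_rtrancl by force
  have "sym (S\<^sup>*)" by (rule sym_rtrancl) (auto simp: S_def sym_def insert_commute)
  then have fwd: "(xs ! 0, xs ! 1) \<in> S\<^sup>*" using bwd by (meson symD)
  have "{(x, y). {x, y} \<in> sedges H} \<subseteq> S\<^sup>*"
  proof safe
    fix x y assume xy: "{x, y} \<in> sedges H"
    show "(x, y) \<in> S\<^sup>*"
    proof (cases "{x, y} = D")
      case True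
      then show ?thesis using fwd bwd by (auto simp: D_def doubleton_eq_iff)
    next
      case False
      then show ?thesis using xy by (auto simp: S_def)
    qed
  qed
  then have "{(x, y). {x, y} \<in> sedges H}\<^sup>* \<subseteq> S\<^sup>*" by (rule rtrancl_subset_rtrancl)
  moreover have "D \<in> sedges H" using ed[of 0] n by (simp add: D_def)
  ultimately show thesis using that unfolding S_def by blast
qed

subsection \<open>Winding numbers\<close>

text \<open>The additive extension of \<open>w\<close> to the free abelian group of integral
  chains.\<close>

definition chain_weight :: "('a \<Rightarrow> complex) \<Rightarrow> ('a \<Rightarrow>\<^sub>0 int) \<Rightarrow> complex" where
  "chain_weight w c = (\<Sum>x\<in>Poly_Mapping.keys c. of_int (Poly_Mapping.lookup c x) * w x)"

lemma chain_weight_superset: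
  assumes "finite S" "Poly_Mapping.keys c \<subseteq> S"
  shows "chain_weight w c = (\<Sum>x\<in>S. of_int (Poly_Mapping.lookup c x) * w x)"
  unfolding chain_weight_def using assms
  by (intro sum.mono_neutral_left) (auto simp: in_keys_iff)

lemma chain_weight_diff: "chain_weight w (a - b) = chain_weight w a - chain_weight w b"
proof -
  let ?S = "Poly_Mapping.keys a \<union> Poly_Mapping.keys b"
  have "chain_weight w (a - b) = (\<Sum>x\<in>?S. of_int (Poly_Mapping.lookup (a - b) x) * w x)"
    using keys_diff[of a b] by (intro chain_weight_superset) auto
  moreover have "chain_weight w a = (\<Sum>x\<in>?S. of_int (Poly_Mapping.lookup a x) * w x)"
    by (intro chain_weight_superset) auto
  moreover have "chain_weight w b = (\<Sum>x\<in>?S. of_int (Poly_Mapping.lookup b x) * w x)"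
    by (intro chain_weight_superset) auto
  ultimately show ?thesis
    by (simp add: lookup_minus left_diff_distrib sum_subtractf)
qed

lemma chain_weight_0 [simp]: "chain_weight w 0 = 0"
  by (simp add: chain_weight_def)

lemma chain_weight_add: "chain_weight w (a + b) = chain_weight w a + chain_weight w b"
  using chain_weight_diff[of w "a + b" b] by simp

lemma chain_weight_of [simp]: "chain_weight w (frag_of x) = w x"
  by (simp add: chain_weight_def)

text \<open>Unspecified if the path has no continuous logarithm.\<close>

definition log_increment :: "(real \<Rightarrow> complex) \<Rightarrow> complex" where
  "log_increment p = (SOME d. \<exists>g. continuous_on {0..1} g \<and> (\<forall>t\<in>{0..1}. p t = exp (g t)) \<and> d = g 1 - g 0)"

text \<open>Two continuous logarithms of one path differ by a continuous function whose values are
  multiples of \<open>2 * pi * \<i>\<close>. Such a function is constant on the interval, so the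
  increment does not depend on the choice.\<close>

lemma log_increment_eq:
  assumes g: "continuous_on {0..1} g" "\<And>t. t \<in> {0..1} \<Longrightarrow> p t = exp (g t)"
  shows "log_increment p = g 1 - g 0"
proof -
  have "\<exists>d h. continuous_on {0..1} h \<and> (\<forall>t\<in>{0..1}. p t = exp (h t)) \<and> d = h 1 - h 0"
    using g by blast
  then have "\<exists>h. continuous_on {0..1} h \<and> (\<forall>t\<in>{0..1}. p t = exp (h t)) \<and> log_increment p = h 1 - h 0"
    unfolding log_increment_def by (rule someI_ex)
  then obtain h where h: "continuous_on {0..1} h" "\<And>t. t \<in> {0..1} \<Longrightarrow> p t = exp (h t)"
    "log_increment p = h 1 - h 0" by blast
  have "(\<lambda>t. g t - h t) constant_on {0..1}"
  proof (rule continuous_discrete_range_constant)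
    show "continuous_on {0..1} (\<lambda>t. g t - h t)" by (intro continuous_intros g h)
    fix x :: real assume x: "x \<in> {0..1}"
    have mult: "\<exists>n::int. g t - h t = of_int (2 * n) * pi * \<i>" if "t \<in> {0..1}" for t
    proof -
      have "exp (g t) = exp (h t)" using g(2)[OF that] h(2)[OF that] by simp
      then obtain n :: int where "g t = h t + (of_int (2 * n) * pi) * \<i>" by (auto simp: exp_eq)
      then show ?thesis by (intro exI[of _ n]) simp
    qed
    have "2 * pi \<le> norm ((g y - h y) - (g x - h x))" if y: "y \<in> {0..1}" "g y - h y \<noteq> g x - h x" for y
    proof -
      obtain m n :: int where mn: "g y - h y = of_int (2 * m) * pi * \<i>" "g x - h x = of_int (2 * n) * pi * \<i>"
        using mult x y by meson
      then have eq: "(g y - h y) - (g x - h x) = of_int (2 * (m - n)) * pi * \<i>" by (simp add: algebra_simps)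
      have "m \<noteq> n" using mn y by auto
      then have "1 \<le> \<bar>real_of_int (m - n)\<bar>" by linarith
      moreover have "norm ((g y - h y) - (g x - h x)) = \<bar>real_of_int (2 * (m - n))\<bar> * pi"
        unfolding eq norm_mult norm_of_int norm_of_real by (simp add: abs_mult)
      ultimately show ?thesis by (simp add: abs_mult)
    qed
    then show "\<exists>e>0. \<forall>y. y \<in> {0..1} \<and> g y - h y \<noteq> g x - h x \<longrightarrow> e \<le> norm ((g y - h y) - (g x - h x))"
      by (intro exI[of _ "2 * pi"]) auto
  qed simp
  then have "g 1 - h 1 = g 0 - h 0" unfolding constant_on_def by force
  then have "g 1 = g 0 - h 0 + h 1" by (simp add: diff_eq_eq)
  then show ?thesis unfolding h(3) by simp
qed

section \<open>Simplices in coordinates and windings of boundaries\<close>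

definition interval_point :: "real \<Rightarrow> nat \<Rightarrow> real" where
  "interval_point t i = (if i = 0 then 1 - t else if i = 1 then t else 0)"

text \<open>Barycentric coordinates: vertices 0, 1, 2 of the simplex correspond to
  \<open>(0, 0)\<close>, \<open>(1, 0)\<close>, \<open>(0, 1)\<close>.\<close>

definition triangle_point :: "real \<times> real \<Rightarrow> nat \<Rightarrow> real" where
  "triangle_point z i =
     (if i = 0 then 1 - fst z - snd z else if i = 1 then fst z else if i = 2 then snd z else 0)"

definition triangle :: "(real \<times> real) set" where
  "triangle = {z. 0 \<le> fst z \<and> 0 \<le> snd z \<and> fst z + snd z \<le> 1}"

lemma interval_point_mem: "t \<in> {0..1} \<Longrightarrow> interval_point t \<in> standard_simplex 1"
  by (auto simp: standard_simplex_def interval_point_def)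

lemma triangle_point_mem: "z \<in> triangle \<Longrightarrow> triangle_point z \<in> standard_simplex 2"
  by (auto simp: standard_simplex_def triangle_point_def triangle_def numeral_2_eq_2)

lemma convex_triangle: "convex triangle"
proof -
  have "triangle = {z. 0 \<le> fst z} \<inter> {z. 0 \<le> snd z} \<inter> {z. fst z + snd z \<le> 1}"
    by (auto simp: triangle_def)
  moreover have "convex {z :: real \<times> real. 0 \<le> fst z}"
    by (auto simp: convex_def)
  moreover have "convex {z :: real \<times> real. 0 \<le> snd z}"
    by (auto simp: convex_def)
  moreover have "convex {z :: real \<times> real. fst z + snd z \<le> 1}"
  proof (rule convexI)
    fix x y :: "real \<times> real" and u v :: real
    assume a: "x \<in> {z. fst z + snd z \<le> 1}" "y \<in> {z. fst z + snd z \<le> 1}" "0 \<le> u" "0 \<le> v" "u + v = 1"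
    have "u * (fst x + snd x) + v * (fst y + snd y) \<le> u * 1 + v * 1"
      using a by (intro add_mono mult_left_mono) auto
    then show "u *\<^sub>R x + v *\<^sub>R y \<in> {z. fst z + snd z \<le> 1}" using a by (simp add: algebra_simps)
  qed
  ultimately show ?thesis by (metis convex_Int)
qed

lemma continuous_triangle_point:
  "continuous_map (top_of_set triangle) (subtopology (powertop_real UNIV) (standard_simplex 2)) triangle_point"
proof -
  have "continuous_on triangle (\<lambda>z. triangle_point z i)" for i
    unfolding triangle_point_def
    by (cases "i = 0"; cases "i = 1"; cases "i = 2"; simp; intro continuous_intros)
  then show ?thesis
    by (auto simp: continuous_map_in_subtopology continuous_map_componentwise_UNIV triangle_point_mem)
qed

lemma face_of_triangle:
  assumes "t \<in> {0..1}"
  shows "singular_face 2 0 \<tau> (interval_point t) = \<tau> (triangle_point (1 - t, t))"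
    and "singular_face 2 1 \<tau> (interval_point t) = \<tau> (triangle_point (0, t))"
    and "singular_face 2 2 \<tau> (interval_point t) = \<tau> (triangle_point (t, 0))"
proof -
  have "simplical_face 0 (interval_point t) = triangle_point (1 - t, t)"
    "simplical_face 1 (interval_point t) = triangle_point (0, t)"
    "simplical_face 2 (interval_point t) = triangle_point (t, 0)"
    by (auto simp: simplical_face_def interval_point_def triangle_point_def fun_eq_iff)
  then show "singular_face 2 0 \<tau> (interval_point t) = \<tau> (triangle_point (1 - t, t))"
    "singular_face 2 1 \<tau> (interval_point t) = \<tau> (triangle_point (0, t))"
    "singular_face 2 2 \<tau> (interval_point t) = \<tau> (triangle_point (t, 0))"
    using interval_point_mem[OF assms] by (simp_all add: singular_face_def)
qed

text \<open>For a loop in the punctured plane this is \<open>2 * pi * \<i>\<close> times the winding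
  number about 0. The increment also makes sense for open paths, so single edges can be
  measured.\<close>

definition winding :: "('a \<Rightarrow> complex) \<Rightarrow> ((nat \<Rightarrow> real) \<Rightarrow> 'a) \<Rightarrow> complex" where
  "winding u \<sigma> = log_increment (\<lambda>t. u (\<sigma> (interval_point t)))"

text \<open>The triangle is contractible, so \<open>u\<close> has a continuous logarithm along all
  of \<open>\<tau>\<close>; the increments over the three faces, with alternating signs,
  cancel.\<close>

lemma winding_boundary_simplex:
  assumes u: "continuous_map X euclidean u" "\<And>x. x \<in> topspace X \<Longrightarrow> u x \<noteq> 0"
    and \<tau>: "singular_simplex 2 X \<tau>"
  shows "chain_weight (winding u) (chain_boundary 2 (frag_of \<tau>)) = 0"
proof -
  define h where "h = (\<lambda>z. u (\<tau> (triangle_point z)))"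
  have \<tau>c: "continuous_map (subtopology (powertop_real UNIV) (standard_simplex 2)) X \<tau>"
    using \<tau> by (simp add: singular_simplex_def)
  have "continuous_map (top_of_set triangle) euclidean (u \<circ> (\<tau> \<circ> triangle_point))"
    by (intro continuous_map_compose[OF _ u(1)] continuous_map_compose[OF continuous_triangle_point \<tau>c])
  then have "continuous_on triangle h" by (simp add: h_def o_def)
  moreover have "h z \<noteq> 0" if "z \<in> triangle" for z
    using u(2) \<tau>c triangle_point_mem[OF that] by (auto simp: h_def continuous_map_def)
  moreover have "contractible triangle" using convex_triangle by (rule convex_imp_contractible)
  ultimately obtain g where g: "continuous_on triangle g" "\<And>z. z \<in> triangle \<Longrightarrow> h z = exp (g z)"
    using continuous_logarithm_on_contractible by metis
  have face: "winding u (singular_face 2 k \<tau>) = g (q 1) - g (q 0)"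
    if q: "continuous_on {0..1} q" "q ` {0..1} \<subseteq> triangle"
      "\<And>t. t \<in> {0..1} \<Longrightarrow> singular_face 2 k \<tau> (interval_point t) = \<tau> (triangle_point (q t))" for k q
    unfolding winding_def
  proof (rule log_increment_eq)
    show "continuous_on {0..1} (\<lambda>t. g (q t))"
      by (rule continuous_on_compose2[OF g(1) q(1,2)])
    show "u (singular_face 2 k \<tau> (interval_point t)) = exp (g (q t))" if "t \<in> {0..1}" for t
    proof -
      have "q t \<in> triangle" using q(2) that by blast
      then show ?thesis using g(2)[of "q t"] q(3)[OF that] by (simp add: h_def)
    qed
  qed
  have "winding u (singular_face 2 0 \<tau>) = g (0, 1) - g (1, 0)"
    using face[of "\<lambda>t. (1 - t, t)", OF _ _ face_of_triangle(1)]
    by (simp add: continuous_on_Pair continuous_on_diff image_subset_iff triangle_def)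
  moreover have "winding u (singular_face 2 1 \<tau>) = g (0, 1) - g (0, 0)"
    using face[of "\<lambda>t. (0, t)", OF _ _ face_of_triangle(2)]
    by (simp add: continuous_on_Pair continuous_on_diff image_subset_iff triangle_def)
  moreover have "winding u (singular_face 2 2 \<tau>) = g (1, 0) - g (0, 0)"
    using face[of "\<lambda>t. (t, 0)", OF _ _ face_of_triangle(3)]
    by (simp add: continuous_on_Pair continuous_on_diff image_subset_iff triangle_def)
  moreover have "chain_boundary 2 (frag_of \<tau>) = frag_of (singular_face 2 0 \<tau>)
      - frag_of (singular_face 2 1 \<tau>) + frag_of (singular_face 2 2 \<tau>)"
    by (simp add: chain_boundary_of numeral_2_eq_2)
  ultimately show ?thesis
    by (simp add: chain_weight_add chain_weight_diff)
qed

text \<open>Linearity reduces the claim to single 2-simplices. In this form a trivial homology class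
  forces a number to vanish.\<close>

lemma winding_boundary:
  assumes u: "continuous_map X euclidean u" "\<And>x. x \<in> topspace X \<Longrightarrow> u x \<noteq> 0"
    and c: "singular_relboundary 1 X {} c"
  shows "chain_weight (winding u) c = 0"
proof -
  obtain d where d: "singular_chain 2 X d" "chain_boundary 2 d = c"
    using c by (auto simp: singular_boundary numeral_2_eq_2)
  have "chain_weight (winding u) (chain_boundary 2 d) = 0"
    using d(1) unfolding singular_chain_def
  proof (induction d rule: frag_induction)
    case (one \<tau>)
    then show ?case using winding_boundary_simplex[OF u] by simp
  qed (simp_all add: chain_boundary_diff chain_weight_diff)
  then show ?thesis using d(2) by simp
qed

text \<open>The coordinate \<open>x 1\<close> serves as the edge parameter, so the simplex runs from
  \<open>end0\<close> to \<open>end1\<close>. The \<open>restrict\<close> is there because singular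
  simplices are extensional functions.\<close>

definition edge_simplex :: "('v, 'e) multigraph \<Rightarrow> 'e \<Rightarrow> (nat \<Rightarrow> real) \<Rightarrow> ('v, 'e) point" where
  "edge_simplex G e = restrict (\<lambda>x. cell_map G e (x 1)) (standard_simplex 1)"

definition vertex_simplex :: "'v \<Rightarrow> (nat \<Rightarrow> real) \<Rightarrow> ('v, 'e) point" where
  "vertex_simplex v = restrict (\<lambda>x. Inl v) (standard_simplex 0)"

lemma singular_edge_simplex:
  assumes "finite_graph G" "e \<in> edges G"
  shows "singular_simplex 1 (graph_topology G) (edge_simplex G e)"
proof -
  let ?\<Delta> = "subtopology (powertop_real UNIV) (standard_simplex 1)"
  have "continuous_map ?\<Delta> euclidean (\<lambda>x. x 1)"
    by (intro continuous_map_from_subtopology continuous_map_product_projection) simp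
  then have "continuous_map ?\<Delta> (top_of_set {0..1}) (\<lambda>x. x 1)"
    by (auto simp: continuous_map_in_subtopology standard_simplex_def)
  from continuous_map_compose[OF this continuous_cell_map[OF assms]]
  have "continuous_map ?\<Delta> (graph_topology G) (edge_simplex G e)"
    by (rule continuous_map_eq) (auto simp: edge_simplex_def)
  then show ?thesis by (simp add: singular_simplex_def edge_simplex_def)
qed

lemma boundary_edge_simplex:
  "chain_boundary 1 (frag_of (edge_simplex G e))
     = frag_of (vertex_simplex (end1 G e)) - frag_of (vertex_simplex (end0 G e))"
proof -
  have "simplical_face 0 x \<in> standard_simplex 1" "simplical_face 1 x \<in> standard_simplex 1"
    if "x \<in> standard_simplex 0" for x :: "nat \<Rightarrow> real"
    using that by (auto intro: simplical_face_in_standard_simplex)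
  then have "singular_face 1 0 (edge_simplex G e) = vertex_simplex (end1 G e)"
    "singular_face 1 1 (edge_simplex G e) = vertex_simplex (end0 G e)"
    by (auto simp: singular_face_def edge_simplex_def vertex_simplex_def fun_eq_iff standard_simplex_0
        simplical_face_def cell_map_def restrict_def)
  then show ?thesis by (simp add: chain_boundary_of)
qed

text \<open>Collapses the complement of the open cell of \<open>d\<close> to the point 1 and wraps
  that cell once around the unit circle, so that windings count signed passages through
  \<open>d\<close>.\<close>

fun edge_wrap :: "nat \<times> nat \<Rightarrow> (nat, nat \<times> nat) point \<Rightarrow> complex" where
  "edge_wrap d (Inl v) = 1"
| "edge_wrap d (Inr (e, t)) = (if e = d then exp (2 * pi * \<i> * t) else 1)"

lemma edge_wrap_cell_map:
  "edge_wrap d (cell_map H e t) = (if e = d then exp (2 * pi * \<i> * t) else 1)"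
  by (auto simp: cell_map_def)

lemma edge_wrap_nonzero: "edge_wrap d x \<noteq> 0"
  by (cases "(d, x)" rule: edge_wrap.cases) auto

lemma continuous_edge_wrap:
  "continuous_map (graph_topology (complete_graph k)) euclidean (edge_wrap d)"
proof (rule continuous_map_graph_topology[OF finite_complete_graph])
  fix e
  show "continuous_map (top_of_set {0..1}) euclidean (edge_wrap d \<circ> cell_map (complete_graph k) e)"
    unfolding o_def edge_wrap_cell_map
    by (cases "e = d") (auto intro!: continuous_intros)
qed simp

text \<open>The increment is \<open>2 * pi * \<i>\<close> or its negative, according to direction,
  when the image runs along the edge between \<open>i\<close> and \<open>j\<close>; otherwise the
  image avoids the open cell and the increment is 0.\<close>

lemma winding_colored_edge:
  assumes "i < j"
  shows "winding (edge_wrap (i, j)) (simplex_map 1 (coloring_map G k f) (edge_simplex G e)) = 0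
    \<longleftrightarrow> {f (end0 G e), f (end1 G e)} \<noteq> {i, j}"
proof -
  let ?p = "\<lambda>t. edge_wrap (i, j) (simplex_map 1 (coloring_map G k f) (edge_simplex G e) (interval_point t))"
  let ?x = "f (end0 G e)" and ?y = "f (end1 G e)"
  have p: "?p t = edge_wrap (i, j) (linear_path k ?x ?y t)" if "t \<in> {0..1}" for t
    using interval_point_mem[OF that]
    by (auto simp: simplex_map_def edge_simplex_def interval_point_def cell_map_def linear_path_def complete_graph_def)
  consider "?x = i" "?y = j" | "?x = j" "?y = i" | "{?x, ?y} \<noteq> {i, j}"
    unfolding doubleton_eq_iff by blast
  then show ?thesis
  proof cases
    case 1
    have "log_increment ?p = 2 * pi * \<i> * of_real 1 - 2 * pi * \<i> * of_real 0"
      by (rule log_increment_eq[where g = "\<lambda>t. 2 * pi * \<i> * of_real t"])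
        (use 1 assms p in \<open>auto intro!: continuous_intros simp: linear_path_def edge_wrap_cell_map\<close>)
    then show ?thesis using 1 by (simp add: winding_def)
  next
    case 2
    \<comment> \<open>A descending pair of colors traverses the cell backwards, hence the parameter
      \<open>1 - t\<close>.\<close>
    have "log_increment ?p = 2 * pi * \<i> * of_real (1 - 1) - 2 * pi * \<i> * of_real (1 - 0)"
      by (rule log_increment_eq[where g = "\<lambda>t. 2 * pi * \<i> * of_real (1 - t)"])
        (use 2 assms p in \<open>auto intro!: continuous_intros simp: linear_path_def edge_wrap_cell_map\<close>)
    then show ?thesis using 2 by (simp add: winding_def insert_commute)
  next
    case 3
    have "log_increment ?p = 0 - 0"
      by (rule log_increment_eq[where g = "\<lambda>t. 0"])
        (use 3 assms p in \<open>auto simp: linear_path_def edge_wrap_cell_map\<close>)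
    then show ?thesis using 3 by (simp add: winding_def)
  qed
qed

text \<open>The winding weight \<open>W\<close> vanishes on cycles because \<open>f\<close> is null.
  The potential at \<open>v\<close> is the weight of a chain from \<open>r v\<close> to
  \<open>v\<close>, so it jumps across an edge by the weight of that edge.\<close>

lemma null_coloring_potential:
  fixes G :: "('v, 'e) multigraph"
  assumes G: "finite_graph G" and f: "null_coloring G k f" and r: "component_rep G r" and "i \<noteq> j"
  obtains g :: "'v \<Rightarrow> complex" where "\<And>v. g (r v) = 0"
    and "\<And>e. e \<in> edges G \<Longrightarrow> g (end0 G e) = g (end1 G e) \<longleftrightarrow> {f (end0 G e), f (end1 G e)} \<noteq> {i, j}"
proof -
  note r_edge = component_rep_edge[OF r] and r_idem = component_rep_idem[OF r]
  \<comment> \<open>Edges of the complete graph are stored as increasing pairs.\<close>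
  define m n where "m = min i j" and "n = max i j"
  have mn: "m < n" "{m, n} = {i, j}" using \<open>i \<noteq> j\<close> by (auto simp: m_def n_def min_def max_def)
  let ?X = "graph_topology G" and ?Y = "graph_topology (complete_graph k)"
  let ?h = "coloring_map G k f"
  have cont: "continuous_map ?X ?Y ?h"
    using continuous_coloring_map[OF G] f by (auto simp: null_coloring_def)
  define W where "W c = chain_weight (winding (edge_wrap (m, n))) (chain_map 1 ?h c)" for c
  have W_add: "W (a + b) = W a + W b" and W_diff: "W (a - b) = W a - W b" for a b
    by (simp_all add: W_def chain_map_add chain_map_diff chain_weight_add chain_weight_diff)
  \<comment> \<open>The induced map kills the class of a cycle, so its image is a boundary and has
    weight 0.\<close>
  have W_cycle: "W c = 0" if "singular_chain 1 ?X c" "chain_boundary 1 c = 0" for c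
  proof -
    have c: "singular_relcycle 1 ?X {} c" using that by (simp add: singular_cycle)
    then have "homologous_rel_set 1 ?X {} c \<in> carrier (homology_group 1 ?X)"
      using carrier_relative_homology_group[of 1 ?X "{}"] by auto
    then have "hom_induced 1 ?X {} ?Y {} ?h (homologous_rel_set 1 ?X {} c) = \<one>\<^bsub>homology_group 1 ?Y\<^esub>"
      using f by (simp add: null_coloring_def)
    then have "homologous_rel_set 1 ?Y {} (chain_map 1 ?h c) = singular_relboundary_set 1 ?Y {}"
      using hom_induced_chain_map[OF cont _ c, of "{}"] one_relative_homology_group[of 1 ?Y "{}"] by simp
    then have "singular_relboundary 1 ?Y {} (chain_map 1 ?h c)"
      by (simp only: homologous_rel_set_eq_relboundary)
    then show ?thesis
      unfolding W_def by (rule winding_boundary[OF continuous_edge_wrap edge_wrap_nonzero])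
  qed
  let ?P = "\<lambda>v c. singular_chain 1 ?X c \<and>
    chain_boundary 1 c = frag_of (vertex_simplex v) - frag_of (vertex_simplex (r v))"
  have "\<exists>c. ?P v c" for v
  \<comment> \<open>A chain from the root is extended across an edge by adding or subtracting the
    edge simplex.\<close>
  proof (rule component_rep_induct[OF r, of "\<lambda>v. \<exists>c. ?P v c"])
    show "\<exists>c. ?P (r v) c" by (rule exI[of _ 0]) (simp add: r_idem)
    fix e assume e: "e \<in> edges G"
    have s: "singular_chain 1 ?X (frag_of (edge_simplex G e))"
      using singular_edge_simplex[OF G e] by (simp add: singular_chain_of)
    show "(\<exists>c. ?P (end0 G e) c) \<longleftrightarrow> (\<exists>c. ?P (end1 G e) c)"
    proof safe
      fix c assume "singular_chain 1 ?X c"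
        "chain_boundary 1 c = frag_of (vertex_simplex (end0 G e)) - frag_of (vertex_simplex (r (end0 G e)))"
      then have "?P (end1 G e) (c + frag_of (edge_simplex G e))"
        using s boundary_edge_simplex[of G e] r_edge[OF e]
        by (simp only: singular_chain_add chain_boundary_add) simp
      then show "\<exists>c. ?P (end1 G e) c" by blast
    next
      fix c assume "singular_chain 1 ?X c"
        "chain_boundary 1 c = frag_of (vertex_simplex (end1 G e)) - frag_of (vertex_simplex (r (end1 G e)))"
      then have "?P (end0 G e) (c - frag_of (edge_simplex G e))"
        using s boundary_edge_simplex[of G e] r_edge[OF e]
        by (simp only: singular_chain_diff chain_boundary_diff) simp
      then show "\<exists>c. ?P (end0 G e) c" by blast
    qed
  qed
  then obtain C where C: "\<And>v. ?P v (C v)" by metis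
  show thesis
  proof
    \<comment> \<open>The chain chosen at a root need not be 0, but it is a cycle.\<close>
    show "W (C (r v)) = 0" for v
      using W_cycle C[of "r v"] r_idem by simp
    fix e assume e: "e \<in> edges G"
    let ?s = "frag_of (edge_simplex G e)"
    \<comment> \<open>Going from the root to one end, across the edge, and back from the other end
      closes up to a cycle.\<close>
    have "W (C (end0 G e) + ?s - C (end1 G e)) = 0"
    proof (rule W_cycle)
      show "singular_chain 1 ?X (C (end0 G e) + ?s - C (end1 G e))"
        using C singular_edge_simplex[OF G e]
        by (intro singular_chain_add singular_chain_diff) (auto simp: singular_chain_of)
      show "chain_boundary 1 (C (end0 G e) + ?s - C (end1 G e)) = 0"
        using C[of "end0 G e"] C[of "end1 G e"] boundary_edge_simplex[of G e] r_edge[OF e]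
        by (simp only: chain_boundary_add chain_boundary_diff) simp
    qed
    then have "W (C (end0 G e)) = W (C (end1 G e)) \<longleftrightarrow> W ?s = 0"
      by (auto simp: W_add W_diff)
    moreover have "W ?s = winding (edge_wrap (m, n)) (simplex_map 1 ?h (edge_simplex G e))"
      by (simp add: W_def)
    ultimately show "W (C (end0 G e)) = W (C (end1 G e)) \<longleftrightarrow> {f (end0 G e), f (end1 G e)} \<noteq> {i, j}"
      using winding_colored_edge[OF mn(1)] mn(2) by simp
  qed
qed

subsection \<open>Homotopies of coloring maps\<close>

lemma openin_prod_discrete:
  "openin (prod_topology (discrete_topology A) T) W \<longleftrightarrow>
     W \<subseteq> A \<times> topspace T \<and> (\<forall>a\<in>A. openin T {t \<in> topspace T. (a, t) \<in> W})" (is "?l \<longleftrightarrow> ?r")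
proof
  assume l: ?l
  have "openin T {t \<in> topspace T. (a, t) \<in> W}" if "a \<in> A" for a
    using openin_continuous_map_preimage[OF _ l, of T "Pair a"] that
    by (simp add: continuous_map_pairwise o_def)
  then show ?r using openin_subset[OF l] by auto
next
  assume r: ?r
  then have "W = (\<Union>a\<in>A. {a} \<times> {t \<in> topspace T. (a, t) \<in> W})" by auto
  moreover have "openin (prod_topology (discrete_topology A) T) ({a} \<times> {t \<in> topspace T. (a, t) \<in> W})"
    if "a \<in> A" for a
    using r that by (simp add: openin_prod_Times_iff)
  ultimately show ?l by (metis (no_types, lifting) openin_Union imageE)
qed

text \<open>As the middle factor is discrete, the product splits into disjoint open pieces, one for
  each \<open>a\<close>. The index set will consist of the cells of a graph.\<close>

lemma continuous_map_prod_discrete: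
  assumes h: "\<And>a. a \<in> A \<Longrightarrow> continuous_map (prod_topology Z T) Y (\<lambda>w. h (fst w, a, snd w))"
  shows "continuous_map (prod_topology Z (prod_topology (discrete_topology A) T)) Y h"
proof -
  let ?P = "prod_topology Z (prod_topology (discrete_topology A) T)"
  have proj: "continuous_map ?P (prod_topology Z T) (\<lambda>w. (fst w, snd (snd w)))"
    by (intro continuous_map_pairedI continuous_map_fst continuous_map_compose[OF continuous_map_snd continuous_map_snd, unfolded o_def])
  have idx: "continuous_map ?P (discrete_topology A) (\<lambda>w. fst (snd w))"
    by (rule continuous_map_compose[OF continuous_map_snd continuous_map_fst, unfolded o_def])
  show ?thesis
    unfolding continuous_map_def
  proof (intro conjI allI impI)
    show "h \<in> topspace ?P \<rightarrow> topspace Y"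
    proof
      fix w assume w: "w \<in> topspace ?P"
      then have a: "fst (snd w) \<in> A" and "(fst w, snd (snd w)) \<in> topspace (prod_topology Z T)" by auto
      from continuous_map_funspace[OF h[OF a]] this(2)
      have "h (fst (fst w, snd (snd w)), fst (snd w), snd (fst w, snd (snd w))) \<in> topspace Y" by (rule funcset_mem)
      then show "h w \<in> topspace Y" by simp
    qed
    fix U assume U: "openin Y U"
    define Q where "Q a = {w \<in> topspace (prod_topology Z T). h (fst w, a, snd w) \<in> U}" for a
    define S where "S a = {w \<in> topspace ?P. (fst w, snd (snd w)) \<in> Q a} \<inter> {w \<in> topspace ?P. fst (snd w) \<in> {a}}" for a
    have "openin ?P (S a)" if "a \<in> A" for a
    proof -
      have "openin (prod_topology Z T) (Q a)"
        unfolding Q_def using h[OF that] U by (rule openin_continuous_map_preimage)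
      then show ?thesis
        unfolding S_def using proj idx that
        by (intro openin_Int openin_continuous_map_preimage[OF proj] openin_continuous_map_preimage[OF idx]) auto
    qed
    moreover have "{x \<in> topspace ?P. h x \<in> U} = (\<Union>a\<in>A. S a)"
      by (auto simp: S_def Q_def)
    ultimately show "openin ?P {x \<in> topspace ?P. h x \<in> U}" by auto
  qed
qed

text \<open>The characteristic maps exhibit the graph as a quotient, and the product of a quotient map with
  the locally compact unit interval is again a quotient map.\<close>

lemma continuous_map_times_graph_topology:
  fixes G :: "('v, 'e) multigraph" and H :: "real \<times> ('v, 'e) point \<Rightarrow> 'b"
  assumes G: "finite_graph G"
    and V: "\<And>v. v \<in> verts G \<Longrightarrow> continuous_map (top_of_set {0..1}) Y (\<lambda>s. H (s, Inl v))"
    and E: "\<And>e. e \<in> edges G \<Longrightarrow> continuous_map (prod_topology (top_of_set {0..1}) (top_of_set {0..1})) Y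
      (\<lambda>w. H (fst w, cell_map G e (snd w)))"
  shows "continuous_map (prod_topology (top_of_set {0..1}) (graph_topology G)) Y H"
proof -
  let ?I = "top_of_set {0..1::real}"
  \<comment> \<open>One interval for each edge and one for each vertex; \<open>q\<close> collapses
    the latter to a point, so isolated vertices are reached too.\<close>
  define A where "A = (Inl ` verts G \<union> Inr ` edges G :: ('v + 'e) set)"
  define q where "q x = (case fst x of Inl v \<Rightarrow> Inl v | Inr e \<Rightarrow> cell_map G e (snd x))" for x :: "('v + 'e) \<times> real"
  let ?D = "prod_topology (discrete_topology A) ?I"
  have "quotient_map ?D (graph_topology G) q"
    unfolding quotient_map_def
  proof (intro conjI allI impI)
    show "q ` topspace ?D = topspace (graph_topology G)"
    proof (intro equalityI subsetI)
      fix y assume "y \<in> q ` topspace ?D"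
      then obtain a t where y: "y = q (a, t)" "a \<in> A" "t \<in> {0..1}" by auto
      show "y \<in> topspace (graph_topology G)"
      proof (cases a)
        case (Inl v)
        then show ?thesis using y by (auto simp: topspace_graph_topology[OF G] q_def A_def points_def)
      next
        case (Inr e)
        then have "e \<in> edges G" using y by (auto simp: A_def)
        then show ?thesis
          using cell_map_in_points[OF G _ y(3)] y Inr by (simp add: topspace_graph_topology[OF G] q_def)
      qed
    next
      fix y assume "y \<in> topspace (graph_topology G)"
      then consider v where "v \<in> verts G" "y = Inl v" | e t where "e \<in> edges G" "0 < t" "t < 1" "y = Inr (e, t)"
        by (auto simp: topspace_graph_topology[OF G] points_def)
      then show "y \<in> q ` topspace ?D"
      proof cases
        case 1
        then show ?thesis by (intro image_eqI[of _ _ "(Inl v, 0)"]) (auto simp: q_def A_def)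
      next
        case 2
        then show ?thesis by (intro image_eqI[of _ _ "(Inr e, t)"]) (auto simp: q_def A_def cell_map_def)
      qed
    qed
    fix U assume U: "U \<subseteq> topspace (graph_topology G)"
    \<comment> \<open>Over a vertex the slice is the whole interval or empty, hence open; only edges
      impose a condition, as in the weak topology.\<close>
    have "(\<forall>a\<in>A. openin ?I {t \<in> topspace ?I. (a, t) \<in> {x \<in> topspace ?D. q x \<in> U}}) \<longleftrightarrow>
      (\<forall>e\<in>edges G. openin ?I {t \<in> {0..1}. cell_map G e t \<in> U})"
    proof -
      have "{t \<in> topspace ?I. (Inl v, t) \<in> {x \<in> topspace ?D. q x \<in> U}} = (if Inl v \<in> U then {0..1} else {})"
        if "v \<in> verts G" for v using that by (auto simp: q_def A_def)
      moreover have "{t \<in> topspace ?I. (Inr e, t) \<in> {x \<in> topspace ?D. q x \<in> U}} = {t \<in> {0..1}. cell_map G e t \<in> U}"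
        if "e \<in> edges G" for e using that by (auto simp: q_def A_def)
      ultimately show ?thesis unfolding A_def ball_Un ball_simps by simp
    qed
    then show "openin ?D {x \<in> topspace ?D. q x \<in> U} \<longleftrightarrow> openin (graph_topology G) U"
      unfolding openin_prod_discrete openin_graph_topology
      using U by (auto simp: topspace_graph_topology[OF G])
  qed
  moreover have "locally_compact_space ?I" "Hausdorff_space ?I"
    by (simp_all add: compact_imp_locally_compact_space compact_space_subtopology Hausdorff_space_subtopology)
  ultimately have "quotient_map (prod_topology ?I ?D) (prod_topology ?I (graph_topology G)) (\<lambda>(x, y). (x, q y))"
    by (simp add: quotient_map_prod_right)
  moreover have "continuous_map (prod_topology ?I ?D) Y (H \<circ> (\<lambda>(x, y). (x, q y)))"
  proof (rule continuous_map_prod_discrete)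
    fix a assume "a \<in> A"
    then consider v where "v \<in> verts G" "a = Inl v" | e where "e \<in> edges G" "a = Inr e"
      by (auto simp: A_def)
    then show "continuous_map (prod_topology ?I ?I) Y (\<lambda>w. (H \<circ> (\<lambda>(x, y). (x, q y))) (fst w, a, snd w))"
    proof cases
      case 1
      have "continuous_map (prod_topology ?I ?I) Y ((\<lambda>s. H (s, Inl v)) \<circ> fst)"
        by (rule continuous_map_compose[OF continuous_map_fst V[OF 1(1)]])
      then show ?thesis using 1 by (simp add: q_def o_def)
    next
      case 2
      then show ?thesis using E[OF 2(1)] by (simp add: q_def)
    qed
  qed
  ultimately show ?thesis by (rule continuous_compose_quotient_map)
qed

text \<open>Colors \<open>i\<close> and \<open>j\<close> serve as coordinates 0 and 1 on the segment
  joining them, and linear paths between them are affine in this coordinate. For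
  \<open>i = j\<close> everything is constant.\<close>

lemma linear_path_segment:
  assumes "x \<in> {i, j}" "y \<in> {i, j}"
  shows "linear_path k x y s =
    linear_path k i j ((1 - s) * of_bool (x = j) + s * of_bool (y = j))"
  using assms by (auto simp: linear_path_def cell_map_def complete_graph_def)

text \<open>Surjectivity is dropped because the colorings met in a later induction miss some
  colors.\<close>

lemma continuous_coloring_map_into:
  assumes G: "finite_graph G" and f: "f ` verts G \<subseteq> {1..k}"
  shows "continuous_map (graph_topology G) (graph_topology (complete_graph k)) (coloring_map G k f)"
proof (rule continuous_map_graph_topology[OF G])
  show "coloring_map G k f (Inl v) \<in> topspace (graph_topology (complete_graph k))" if "v \<in> verts G" for v
    using f that unfolding coloring_map.simps vertex_in_complete_graph by blast
  fix e assume "e \<in> edges G"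
  then have "f (end0 G e) \<in> {1..k}" "f (end1 G e) \<in> {1..k}"
    using f G by (simp_all only: finite_graph_def image_subset_iff)
  moreover have "coloring_map G k f \<circ> cell_map G e = linear_path k (f (end0 G e)) (f (end1 G e))"
    by (auto simp: cell_map_def linear_path_def complete_graph_def)
  ultimately show "continuous_map (top_of_set {0..1}) (graph_topology (complete_graph k))
      (coloring_map G k f \<circ> cell_map G e)"
    by (simp add: continuous_linear_path)
qed

text \<open>Along each edge both maps stay in one segment of the complete graph, where coordinates
  can be interpolated linearly. A vertex moves along the linear path from its old to its new color,
  consistently with all edges at it.\<close>

lemma homotopic_coloring_maps:
  fixes G :: "('v, 'e) multigraph"
  assumes G: "finite_graph G" and f: "f ` verts G \<subseteq> {1..k}" and f': "f' ` verts G \<subseteq> {1..k}"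
    and two: "\<And>e. e \<in> edges G \<Longrightarrow>
      \<exists>i j. {f (end0 G e), f (end1 G e), f' (end0 G e), f' (end1 G e)} \<subseteq> {i, j}"
  shows "homotopic_with (\<lambda>h. True) (graph_topology G) (graph_topology (complete_graph k))
    (coloring_map G k f) (coloring_map G k f')"
proof -
  let ?I = "top_of_set {0..1::real}" and ?K = "graph_topology (complete_graph k)"
  have "\<exists>i j. i \<in> {1..k} \<and> j \<in> {1..k} \<and>
    {f (end0 G e), f (end1 G e), f' (end0 G e), f' (end1 G e)} \<subseteq> {i, j}" if e: "e \<in> edges G" for e
  proof -
    define T where "T = {f (end0 G e), f (end1 G e), f' (end0 G e), f' (end1 G e)}"
    have T: "T \<subseteq> {1..k}"
      unfolding T_def using e G f f' by (simp only: finite_graph_def image_subset_iff insert_subset) simp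
    have "T \<noteq> {}" by (simp add: T_def)
    obtain i j where "T \<subseteq> {i, j}" using two[OF e] unfolding T_def by metis
    \<comment> \<open>The colors supplied by \<open>two\<close> may lie outside the range; a
      covering pair can be picked from the nonempty \<open>T\<close> itself.\<close>
    then have "\<exists>i\<in>T. \<exists>j\<in>T. T \<subseteq> {i, j}" using \<open>T \<noteq> {}\<close> by blast
    then have "\<exists>i j. i \<in> {1..k} \<and> j \<in> {1..k} \<and> T \<subseteq> {i, j}" using T by blast
    then show ?thesis unfolding T_def .
  qed
  then obtain i j where ij: "\<And>e. e \<in> edges G \<Longrightarrow> i e \<in> {1..k} \<and> j e \<in> {1..k} \<and>
    {f (end0 G e), f (end1 G e), f' (end0 G e), f' (end1 G e)} \<subseteq> {i e, j e}" by metis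
  \<comment> \<open>The coordinate on the segment from \<open>i e\<close> to \<open>j e\<close>,
    interpolated in the time \<open>s\<close> and the edge parameter \<open>t\<close>.\<close>
  define pos where "pos e s t =
    (1 - s) * ((1 - t) * of_bool (f (end0 G e) = j e) + t * of_bool (f (end1 G e) = j e)) +
    s * ((1 - t) * of_bool (f' (end0 G e) = j e) + t * of_bool (f' (end1 G e) = j e))" for e and s t :: real
  define H where "H w = (case snd w of Inl v \<Rightarrow> linear_path k (f v) (f' v) (fst w)
    | Inr (e, t) \<Rightarrow> linear_path k (i e) (j e) (pos e (fst w) t))" for w
  \<comment> \<open>At \<open>t = 0\<close> and \<open>t = 1\<close> the formula for the edge agrees
    with the one for its end vertices.\<close>
  have H_cell: "H (s, cell_map G e t) = linear_path k (i e) (j e) (pos e s t)"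
    if e: "e \<in> edges G" for e s t
    using ij[OF e] linear_path_segment[of "f (end0 G e)" "i e" "j e" "f' (end0 G e)" k s]
      linear_path_segment[of "f (end1 G e)" "i e" "j e" "f' (end1 G e)" k s]
    by (simp add: H_def cell_map_def pos_def)
  have pos01: "pos e s t \<in> {0..1}" if "s \<in> {0..1}" "t \<in> {0..1}" for e s t
  proof -
    have conv: "(1 - a) * x + a * y \<in> {0..1}" if "a \<in> {0..1}" "x \<in> {0..1}" "y \<in> {0..1}" for a x y :: real
      using that convex_bound_le[of x 1 y "1 - a" a] by auto
    show ?thesis unfolding pos_def by (intro conv that) auto
  qed
  have "continuous_map (prod_topology ?I (graph_topology G)) ?K H"
  proof (rule continuous_map_times_graph_topology[OF G])
    fix v assume "v \<in> verts G"
    then have "f v \<in> {1..k}" "f' v \<in> {1..k}" using f f' by auto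
    then show "continuous_map ?I ?K (\<lambda>s. H (s, Inl v))"
      using continuous_linear_path by (simp add: H_def)
  next
    fix e assume e: "e \<in> edges G"
    have "continuous_on ({0..1} \<times> {0..1}) (\<lambda>w. pos e (fst w) (snd w))"
      unfolding pos_def by (intro continuous_intros)
    then have "continuous_map (prod_topology ?I ?I) ?I (\<lambda>w. pos e (fst w) (snd w))"
      using pos01 by (auto simp: continuous_map_in_subtopology simp flip: subtopology_Times)
    from continuous_map_compose[OF this continuous_linear_path[of "i e" k "j e"]] ij[OF e]
    have "continuous_map (prod_topology ?I ?I) ?K (\<lambda>w. linear_path k (i e) (j e) (pos e (fst w) (snd w)))"
      by (simp add: o_def)
    then show "continuous_map (prod_topology ?I ?I) ?K (\<lambda>w. H (fst w, cell_map G e (snd w)))"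
      by (simp add: H_cell[OF e])
  qed
  moreover have "H (0, x) = coloring_map G k f x" "H (1, x) = coloring_map G k f' x"
    if "x \<in> topspace (graph_topology G)" for x
  proof -
    consider v where "x = Inl v" | e t where "e \<in> edges G" "0 < t" "t < 1" "x = Inr (e, t)"
      using \<open>x \<in> _\<close> by (auto simp: topspace_graph_topology[OF G] points_def)
    then have "H (0, x) = coloring_map G k f x \<and> H (1, x) = coloring_map G k f' x"
    proof cases
      case 1
      then show ?thesis by (simp add: H_def linear_path_def cell_map_def complete_graph_def)
    next
      case 2
      have "linear_path k (f (end0 G e)) (f (end1 G e)) t = linear_path k (i e) (j e) (pos e 0 t)"
        "linear_path k (f' (end0 G e)) (f' (end1 G e)) t = linear_path k (i e) (j e) (pos e 1 t)"
        using ij[OF 2(1)] linear_path_segment[of "f (end0 G e)" "i e" "j e" "f (end1 G e)" k t]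
          linear_path_segment[of "f' (end0 G e)" "i e" "j e" "f' (end1 G e)" k t]
        by (simp_all add: pos_def)
      then show ?thesis using 2 by (simp add: H_def)
    qed
    then show "H (0, x) = coloring_map G k f x" "H (1, x) = coloring_map G k f' x" by auto
  qed
  ultimately show ?thesis
    by (subst homotopic_with) auto
qed

section \<open>Colorings constant on components\<close>

lemma relboundary_constant_simplex:
  assumes "x \<in> topspace X"
  shows "singular_relboundary 1 X {} (frag_of (restrict (\<lambda>z. x) (standard_simplex 1)))"
proof -
  let ?S = "subtopology X {x}"
  have t: "topspace ?S = {x}" using assms by auto
  \<comment> \<open>In a one-point space every chain of odd degree is a boundary.\<close>
  have "singular_relboundary 1 ?S {} (frag_of (restrict (\<lambda>z. x) (standard_simplex 1)))"
    unfolding singular_boundary_singleton[OF t] singular_chain_of singular_simplex_singleton[OF t] by simp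
  then have "singular_relboundary 1 (subtopology X UNIV) {} (frag_of (restrict (\<lambda>z. x) (standard_simplex 1)))"
    by (rule singular_boundary_mono[rotated]) simp
  then show ?thesis by simp
qed

text \<open>The color extends to a continuous map \<open>\<phi>\<close> into a discrete space. A
  singular 1-simplex has connected image, so \<open>\<phi>\<close> is constant on it; it is sent to
  a constant simplex, which is a boundary.\<close>

lemma hom_induced_locally_constant_coloring:
  fixes G :: "('v, 'e) multigraph"
  assumes G: "finite_graph G" and f: "f ` verts G \<subseteq> {1..k}"
    and const: "\<And>e. e \<in> edges G \<Longrightarrow> f (end0 G e) = f (end1 G e)"
    and c: "c \<in> carrier (homology_group 1 (graph_topology G))"
  shows "hom_induced 1 (graph_topology G) {} (graph_topology (complete_graph k)) {} (coloring_map G k f) c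
    = \<one>\<^bsub>homology_group 1 (graph_topology (complete_graph k))\<^esub>"
proof -
  let ?X = "graph_topology G" and ?K = "graph_topology (complete_graph k)" and ?h = "coloring_map G k f"
  define \<phi> where "\<phi> x = (case x of Inl v \<Rightarrow> f v | Inr (e, t) \<Rightarrow> f (end0 G e))" for x :: "('v, 'e) point"
  have "continuous_map ?X (discrete_topology UNIV) \<phi>"
  proof (rule continuous_map_graph_topology[OF G])
    fix e assume e: "e \<in> edges G"
    have "\<phi> \<circ> cell_map G e = (\<lambda>t. f (end0 G e))" using const[OF e] by (auto simp: \<phi>_def cell_map_def)
    then show "continuous_map (top_of_set {0..1}) (discrete_topology UNIV) (\<phi> \<circ> cell_map G e)" by simp
  qed simp
  moreover have h\<phi>: "?h x = Inl (\<phi> x)" if "x \<in> topspace ?X" for x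
    using that const by (auto simp: topspace_graph_topology[OF G] points_def \<phi>_def linear_path_def)
  have simplex: "singular_relboundary 1 ?K {} (chain_map 1 ?h (frag_of \<sigma>))" if \<sigma>: "singular_simplex 1 ?X \<sigma>" for \<sigma>
  proof -
    let ?\<Delta> = "subtopology (powertop_real UNIV) (standard_simplex 1)"
    have \<sigma>c: "continuous_map ?\<Delta> ?X \<sigma>" using \<sigma> by (simp add: singular_simplex_def)
    have conn: "connectedin ?\<Delta> (standard_simplex 1)"
      using connectedin_standard_simplex by (simp add: connectedin_subtopology)
    have "connectedin (discrete_topology UNIV) ((\<phi> \<circ> \<sigma>) ` standard_simplex 1)"
      by (rule connectedin_continuous_map_image[OF continuous_map_compose[OF \<sigma>c calculation] conn])
    then obtain a where "(\<phi> \<circ> \<sigma>) ` standard_simplex 1 \<subseteq> {a}"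
      unfolding connectedin_discrete_topology by blast
    then have a: "\<And>x. x \<in> standard_simplex 1 \<Longrightarrow> \<phi> (\<sigma> x) = a" by auto
    have mem: "\<sigma> x \<in> topspace ?X" if "x \<in> standard_simplex 1" for x
      using \<sigma>c that by (auto simp: continuous_map_def)
    have "simplex_map 1 ?h \<sigma> = restrict (\<lambda>x. Inl a) (standard_simplex 1)"
      using a h\<phi> mem by (auto simp: simplex_map_def restrict_def fun_eq_iff)
    moreover have "Inl a \<in> topspace ?K"
    proof -
      obtain x :: "nat \<Rightarrow> real" where x: "x \<in> standard_simplex 1" using nonempty_standard_simplex by blast
      then have "?h (\<sigma> x) = Inl a" using a h\<phi> mem by simp
      moreover have "?h (\<sigma> x) \<in> topspace ?K"
        using continuous_coloring_map_into[OF G f] mem[OF x] by (auto simp: continuous_map_def)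
      ultimately show ?thesis by simp
    qed
    ultimately show ?thesis using relboundary_constant_simplex by simp
  qed
  obtain d where d: "singular_relcycle 1 ?X {} d" "c = homologous_rel_set 1 ?X {} d"
    using c carrier_relative_homology_group[of 1 ?X "{}"] by auto
  then have "Poly_Mapping.keys d \<subseteq> singular_simplex_set 1 ?X"
    by (simp add: singular_cycle singular_chain_def)
  then have "singular_relboundary 1 ?K {} (chain_map 1 ?h d)"
  proof (induction d rule: frag_induction)
    case zero
    then show ?case by simp
  next
    case (one \<sigma>)
    then show ?case using simplex by blast
  next
    case (diff a b)
    then show ?case by (simp only: chain_map_diff singular_relboundary_diff)
  qed
  then show ?thesis
    using hom_induced_chain_map[OF continuous_coloring_map_into[OF G f] _ d(1), of "{}"]
      one_relative_homology_group[of 1 ?K "{}"] d(2) homologous_rel_set_eq_relboundary[of 1 ?K "{}"]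
    by simp
qed

subsection \<open>Colorings from laminar families of cuts\<close>

text \<open>Members and roots are numbered jointly. All colors occur, because roots lie outside
  every member and each member is innermost at some vertex. Nullity follows by removing minimal
  members one at a time.\<close>

lemma null_coloring_of_laminar_cuts:
  fixes G :: "('v, 'e) multigraph"
  assumes G: "finite_graph G" and r: "component_rep G r"
    and FV: "F \<subseteq> Pow (verts G - r ` verts G) - {{}}"
    and F: "edge_disjoint_cuts G F" "laminar F"
    and sep: "\<And>A. A \<in> F \<Longrightarrow> \<exists>e\<in>edges G. separates G A e"
  shows "\<exists>f. null_coloring G (card F + card (r ` verts G)) f"
proof -
  let ?R = "r ` verts G"
  define k where "k = card F + card ?R"
  let ?X = "graph_topology G" and ?K = "graph_topology (complete_graph k)"
  have finV: "finite (verts G)" using G by (simp add: finite_graph_def)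
  have finF: "finite F" using FV finV by (meson finite_Diff finite_Pow_iff finite_subset)
  have "card (F <+> ?R) = card {1..k}" using finF finV by (simp add: card_Plus k_def)
  then obtain h where h: "bij_betw h (F <+> ?R) {1..k}"
    using bij_betw_iff_card[of "F <+> ?R" "{1..k}"] finF finV by auto
  define a where "a A = h (Inl A)" for A
  define b where "b v = h (Inr (r v))" for v
  have aF: "a A \<in> {1..k}" if "A \<in> F" for A
    unfolding a_def by (rule bij_betwE[OF h, rule_format]) (use that in blast)
  have bV: "b v \<in> {1..k}" if "v \<in> verts G" for v
    unfolding b_def by (rule bij_betwE[OF h, rule_format]) (use that in blast)
  have b_edge: "b (end0 G e) = b (end1 G e)" if "e \<in> edges G" for e
    using component_rep_edge[OF r that] by (simp add: b_def)
  have sub: "edge_disjoint_cuts G F'" "laminar F'" "finite F'" if "F' \<subseteq> F" for F'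
    using F that finF unfolding edge_disjoint_cuts_def laminar_def
    by (meson subsetD finite_subset)+
  have range: "cut_color a b F' ` verts G \<subseteq> {1..k}" if F': "F' \<subseteq> F" for F'
  proof (rule image_subsetI)
    fix v assume v: "v \<in> verts G"
    show "cut_color a b F' v \<in> {1..k}"
    proof (cases "{A \<in> F'. v \<in> A} = {}")
      case True
      then show ?thesis using bV[OF v] by (simp only: cut_color_outside)
    next
      case False
      then have "\<Inter> {A \<in> F'. v \<in> A} \<in> F"
        using Inter_laminar_mem[OF sub(3,2)[OF F'] False] F' by blast
      then show ?thesis unfolding cut_color_inside[OF False] by (rule aF)
    qed
  qed
  \<comment> \<open>Stated for all subfamilies with \<open>k\<close> and the numbering fixed, so
    that all maps in the induction share one target.\<close>
  have trivial: "hom_induced 1 ?X {} ?K {} (coloring_map G k (cut_color a b F')) c = \<one>\<^bsub>homology_group 1 ?K\<^esub>"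
    if "F' \<subseteq> F" "c \<in> carrier (homology_group 1 ?X)" for F' c
    using sub(3)[OF that(1)] that
  proof (induction F' rule: finite_psubset_induct)
    case (psubset F')
    show ?case
    proof (cases "F' = {}")
      case True
      have "cut_color a b F' = b" using True by (intro ext cut_color_outside) simp
      then show ?thesis
        using hom_induced_locally_constant_coloring[OF G _ b_edge psubset.prems(2)] bV by (simp add: image_subset_iff)
    next
      case False
      from finite_has_minimal[OF psubset.hyps(1) False]
      obtain A where A: "A \<in> F'" "\<forall>B\<in>F'. B \<subseteq> A \<longrightarrow> A = B" ..
      have "homotopic_with (\<lambda>h. True) ?X ?K (coloring_map G k (cut_color a b F'))
          (coloring_map G k (cut_color a b (F' - {A})))"
      proof (rule homotopic_coloring_maps[OF G])
        show "cut_color a b F' ` verts G \<subseteq> {1..k}" "cut_color a b (F' - {A}) ` verts G \<subseteq> {1..k}"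
          using range psubset.prems(1) by blast+
        fix e assume "e \<in> edges G"
        then show "\<exists>i j. {cut_color a b F' (end0 G e), cut_color a b F' (end1 G e),
            cut_color a b (F' - {A}) (end0 G e), cut_color a b (F' - {A}) (end1 G e)} \<subseteq> {i, j}"
          using A b_edge sub[OF psubset.prems(1)] by (intro cut_color_remove_minimal) auto
      qed
      then have "hom_induced 1 ?X {} ?K {} (coloring_map G k (cut_color a b F')) =
          hom_induced 1 ?X {} ?K {} (coloring_map G k (cut_color a b (F' - {A})))"
        by (rule homology_homotopy_empty)
      moreover have "F' - {A} \<subset> F'" using A(1) by blast
      ultimately show ?thesis using psubset.IH[of "F' - {A}"] psubset.prems by auto
    qed
  qed
  have "cut_color a b F ` verts G = {1..k}"
  proof
    show "{1..k} \<subseteq> cut_color a b F ` verts G"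
    proof
      fix n assume "n \<in> {1..k}"
      then obtain x where x: "x \<in> F <+> ?R" "h x = n" using h by (metis bij_betw_imp_surj_on imageE)
      from x(1) show "n \<in> cut_color a b F ` verts G"
      proof (rule PlusE)
        fix A assume A: "A \<in> F" "x = Inl A"
        then have "A \<noteq> {}" using FV by blast
        obtain v where v: "v \<in> A" "\<Inter> {B \<in> F. v \<in> B} = A"
          using exists_innermost_vertex[OF finF F A(1) \<open>A \<noteq> {}\<close> sep] .
        have "{B \<in> F. v \<in> B} \<noteq> {}" using A v by blast
        then have "cut_color a b F v = a A" unfolding v(2)[symmetric] by (rule cut_color_inside)
        then have "cut_color a b F v = n" using x A by (simp add: a_def)
        moreover have "A \<subseteq> verts G" using FV A(1) by auto
        ultimately show ?thesis using v(1) by (metis image_eqI subsetD)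
      next
        fix y assume y: "y \<in> ?R" "x = Inr y"
        have "y \<notin> B" if "B \<in> F" for B using FV that y(1) by auto
        then have "{B \<in> F. y \<in> B} = {}" by simp
        then have "cut_color a b F y = b y" by (rule cut_color_outside)
        also have "b y = n" using y component_rep_idem[OF r] x by (auto simp: b_def)
        finally have "cut_color a b F y = n" .
        moreover have "y \<in> verts G" using y(1) component_rep_verts[OF r] by auto
        ultimately show ?thesis by (metis image_eqI)
      qed
    qed
  qed (rule range[OF order_refl])
  then have "null_coloring G k (cut_color a b F)"
    using trivial[OF order_refl] by (simp add: null_coloring_def coloring_def)
  then show ?thesis unfolding k_def by blast
qed

section \<open>Comparing the number of colors with the number of quotient edges\<close>

theorem theorem2:
  fixes G :: "('v, 'e) multigraph" and f :: "'v \<Rightarrow> nat" and k :: nat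
  assumes "finite_graph G" and "maximal_null_coloring G k f"
  shows "forest (quotient_graph G f)"
  unfolding forest_def
proof (rule notI, elim exE)
  note G = assms(1)
  have null: "null_coloring G k f" and max: "\<And>k' f'. null_coloring G k' f' \<Longrightarrow> k' \<le> k"
    using assms(2) by (auto simp: maximal_null_coloring_def)
  let ?H = "quotient_graph G f"
  fix xs assume cyc: "cycle ?H xs"
  obtain r where r: "component_rep G r" using component_rep_exists[OF G] .
  let ?R = "r ` verts G"
  define cls where "cls v = color_class G f (f v)" for v
  have finV: "finite (verts G)" and ends: "\<And>e. e \<in> edges G \<Longrightarrow> end0 G e \<in> verts G \<and> end1 G e \<in> verts G"
    using G by (auto simp: finite_graph_def)
  have sverts: "sverts ?H = cls ` verts G"
    by (auto simp: quotient_graph_def cls_def)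
  have cls_mem: "A = cls v" if "A \<in> cls ` verts G" "v \<in> A" for A v
    using that by (auto simp: cls_def color_class_def)
  have sedges: "D \<in> sedges ?H \<longleftrightarrow> (\<exists>e\<in>edges G. cls (end0 G e) \<noteq> cls (end1 G e) \<and> D = {cls (end0 G e), cls (end1 G e)})" for D
  proof
    assume "D \<in> sedges ?H"
    then obtain A B e where "D = {A, B}" "A \<in> cls ` verts G" "B \<in> cls ` verts G" "A \<noteq> B"
      "e \<in> edges G" "end0 G e \<in> A" "end1 G e \<in> B"
      by (auto simp: quotient_graph_def cls_def)
    then show "\<exists>e\<in>edges G. cls (end0 G e) \<noteq> cls (end1 G e) \<and> D = {cls (end0 G e), cls (end1 G e)}"
      using cls_mem by metis
  next
    assume "\<exists>e\<in>edges G. cls (end0 G e) \<noteq> cls (end1 G e) \<and> D = {cls (end0 G e), cls (end1 G e)}"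
    then obtain e where e: "e \<in> edges G" "cls (end0 G e) \<noteq> cls (end1 G e)" "D = {cls (end0 G e), cls (end1 G e)}"
      by blast
    moreover have "end0 G e \<in> cls (end0 G e)" "end1 G e \<in> cls (end1 G e)"
      using ends[OF e(1)] by (auto simp: cls_def color_class_def)
    ultimately show "D \<in> sedges ?H"
      using ends[OF e(1)] unfolding quotient_graph_def cls_def by auto
  qed
  \<comment> \<open>Without a separated edge, \<open>A\<close> would contain the root of each of its
    vertices.\<close>
  have cuts_sep: "\<exists>e\<in>edges G. separates G A e" if AV: "A \<subseteq> verts G - ?R" and ne: "A \<noteq> {}" for A
  proof (rule ccontr)
    assume "\<not> (\<exists>e\<in>edges G. separates G A e)"
    then have inv: "\<And>e. e \<in> edges G \<Longrightarrow> (end0 G e \<notin> A) \<longleftrightarrow> (end1 G e \<notin> A)" by (auto simp: separates_def)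
    obtain v where v: "v \<in> A" using ne by blast
    then have "r v \<notin> A" using AV by blast
    then have "v \<notin> A" by (rule component_rep_induct[OF r, of "\<lambda>v. v \<notin> A"]) (rule inv)
    then show False using v by simp
  qed
  \<comment> \<open>Each quotient edge yields a cut: the support of the potential for its two
    colors.\<close>
  have "\<exists>C. C \<subseteq> verts G - ?R \<and> C \<noteq> {} \<and>
      (\<forall>e\<in>edges G. separates G C e \<longrightarrow> {cls (end0 G e), cls (end1 G e)} = D)" if D: "D \<in> sedges ?H" for D
  proof -
    obtain e\<^sub>0 where e0: "e\<^sub>0 \<in> edges G" "cls (end0 G e\<^sub>0) \<noteq> cls (end1 G e\<^sub>0)" "D = {cls (end0 G e\<^sub>0), cls (end1 G e\<^sub>0)}"
      using D unfolding sedges by blast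
    define i j where "i = f (end0 G e\<^sub>0)" and "j = f (end1 G e\<^sub>0)"
    have "i \<noteq> j" using e0(2) by (auto simp: cls_def i_def j_def)
    from null_coloring_potential[OF G null r this]
    obtain g :: "'v \<Rightarrow> complex" where g: "\<And>v. g (r v) = 0"
      "\<And>e. e \<in> edges G \<Longrightarrow> g (end0 G e) = g (end1 G e) \<longleftrightarrow> {f (end0 G e), f (end1 G e)} \<noteq> {i, j}"
      by blast
    let ?C = "{v \<in> verts G. g v \<noteq> 0}"
    have "?C \<subseteq> verts G - ?R" using g(1) by auto
    moreover have "g (end0 G e\<^sub>0) \<noteq> g (end1 G e\<^sub>0)" using g(2)[OF e0(1)] by (simp add: i_def j_def)
    then have "end0 G e\<^sub>0 \<in> ?C \<or> end1 G e\<^sub>0 \<in> ?C" using ends[OF e0(1)] by auto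
    then have "?C \<noteq> {}" by blast
    moreover have "{cls (end0 G e), cls (end1 G e)} = D" if e: "e \<in> edges G" "separates G ?C e" for e
    proof -
      have "g (end0 G e) \<noteq> g (end1 G e)" using e ends[OF e(1)] by (auto simp: separates_def)
      then have "{f (end0 G e), f (end1 G e)} = {i, j}" using g(2)[OF e(1)] by blast
      then have "color_class G f ` {f (end0 G e), f (end1 G e)} = color_class G f ` {i, j}" by (simp only:)
      then show ?thesis using e0(3) by (simp add: cls_def i_def j_def)
    qed
    ultimately show ?thesis by blast
  qed
  then obtain C where C: "\<And>D. D \<in> sedges ?H \<Longrightarrow> C D \<subseteq> verts G - ?R \<and> C D \<noteq> {}"
    and C_sep: "\<And>D e. \<lbrakk>D \<in> sedges ?H; e \<in> edges G; separates G (C D) e\<rbrakk> \<Longrightarrow> {cls (end0 G e), cls (end1 G e)} = D"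
    by metis
  \<comment> \<open>An edge crossing \<open>C D\<close> joins the two classes in \<open>D\<close>
    and thus determines \<open>D\<close>.\<close>
  have "inj_on C (sedges ?H)"
  proof (rule inj_onI)
    fix D D' assume D: "D \<in> sedges ?H" "D' \<in> sedges ?H" "C D = C D'"
    obtain e where "e \<in> edges G" "separates G (C D) e" using cuts_sep C[OF D(1)] by blast
    then show "D = D'" using C_sep[OF D(1)] C_sep[OF D(2)] D(3) by metis
  qed
  then have card_F: "card (C ` sedges ?H) = card (sedges ?H)" by (rule card_image)
  have "edge_disjoint_cuts G (C ` sedges ?H)"
    unfolding edge_disjoint_cuts_def using C_sep by blast
  moreover have "C ` sedges ?H \<subseteq> Pow (verts G - ?R) - {{}}" using C by blast
  moreover have "finite (verts G - ?R)" using finV by simp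
  ultimately obtain F where F: "F \<subseteq> Pow (verts G - ?R) - {{}}" "edge_disjoint_cuts G F" "laminar F"
    "card F = card (C ` sedges ?H)"
    using exists_laminar_cuts[of "verts G - ?R" "C ` sedges ?H" G] cuts_sep by blast
  have "\<exists>e\<in>edges G. separates G A e" if "A \<in> F" for A using cuts_sep F(1) that by blast
  \<comment> \<open>Maximality applied to the new coloring, which has one color per quotient edge
    and one per root.\<close>
  from null_coloring_of_laminar_cuts[OF G r F(1-3) this] max
  have upper: "card (sedges ?H) + card ?R \<le> k" using F(4) card_F by auto
  define adj where "adj = {(x, y). {x, y} \<in> sedges ?H}"
  \<comment> \<open>Walks in \<open>G\<close> project to walks in the quotient, with steps inside a
    class collapsing.\<close>
  have reach: "(cls (r v), cls v) \<in> adj\<^sup>*" for v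
  proof (rule component_rep_induct[OF r, of "\<lambda>v. (cls (r v), cls v) \<in> adj\<^sup>*"])
    show "(cls (r (r v)), cls (r v)) \<in> adj\<^sup>*" by (simp add: component_rep_idem[OF r])
    fix e assume e: "e \<in> edges G"
    show "(cls (r (end0 G e)), cls (end0 G e)) \<in> adj\<^sup>* \<longleftrightarrow> (cls (r (end1 G e)), cls (end1 G e)) \<in> adj\<^sup>*"
    proof (cases "cls (end0 G e) = cls (end1 G e)")
      case True
      then show ?thesis using component_rep_edge[OF r e] by simp
    next
      case False
      then have "{cls (end0 G e), cls (end1 G e)} \<in> sedges ?H" using sedges e by blast
      then have "(cls (end0 G e), cls (end1 G e)) \<in> adj" "(cls (end1 G e), cls (end0 G e)) \<in> adj"
        by (simp_all add: adj_def insert_commute)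
      then show ?thesis using component_rep_edge[OF r e] by (auto intro: rtrancl_into_rtrancl)
    qed
  qed
  \<comment> \<open>After deleting an edge of the cycle, every class is still reachable from the
    class of a root. The count below therefore does with one edge fewer, which contradicts
    \<open>upper\<close>.\<close>
  obtain D where D: "D \<in> sedges ?H" "adj\<^sup>* \<subseteq> {(x, y). {x, y} \<in> sedges ?H - {D}}\<^sup>*"
    using cycle_edge_removable[OF cyc] unfolding adj_def .
  have "sedges ?H \<subseteq> Pow (cls ` verts G)"
  proof
    fix D assume "D \<in> sedges ?H"
    then obtain e where "e \<in> edges G" "D = {cls (end0 G e), cls (end1 G e)}" unfolding sedges by blast
    then show "D \<in> Pow (cls ` verts G)" using ends[of e] by simp
  qed
  then have fin: "finite (sedges ?H)" using finV by (meson finite_Pow_iff finite_imageI finite_subset)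
  have "card (cls ` verts G) \<le> card (cls ` ?R) + card (sedges ?H - {D})"
  proof (rule card_verts_le_roots_plus_edges)
    fix x assume "x \<in> cls ` verts G"
    then obtain v where v: "v \<in> verts G" "x = cls v" by blast
    have "(cls (r v), x) \<in> {(x, y). {x, y} \<in> sedges ?H - {D}}\<^sup>*"
      unfolding v(2) by (rule subsetD[OF D(2) reach])
    then show "\<exists>y\<in>cls ` ?R. (y, x) \<in> {(x, y). {x, y} \<in> sedges ?H - {D}}\<^sup>*"
      by (intro bexI[of _ "cls (r v)"]) (use v(1) in simp_all)
  qed (use fin finV in simp_all)
  \<comment> \<open>Several roots may lie in one color class.\<close>
  moreover have "card (cls ` ?R) \<le> card ?R" using finV by (simp add: card_image_le)
  moreover have "card (sedges ?H - {D}) < card (sedges ?H)" using fin D(1) by (rule card_Diff1_less)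
  moreover have "card (cls ` verts G) = k"
  proof -
    have "cls ` verts G = color_class G f ` (f ` verts G)" by (auto simp: cls_def)
    moreover have "inj_on (color_class G f) (f ` verts G)" by (auto simp: inj_on_def color_class_def)
    ultimately have "card (cls ` verts G) = card (f ` verts G)" by (simp add: card_image)
    then show ?thesis using null by (simp add: null_coloring_def coloring_def)
  qed
  ultimately show False using upper by linarith
qed

end
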